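(* Let $\mathrm{CLKID}^\omega_{-}$ denote $\mathrm{CLKID}^\omega$ without the rule $(\mathrm{Cut})$. Fix a signature and an inductive definition set $\Phi$. If $\mathrm{Pr}$ is a $\mathrm{CLKID}^\omega_{-}$ proof of $\Gamma\vdash\Delta$ in which every substitution used in an instance of $(\mathrm{Subst})$ is atomic, then there is a $\mathrm{CLKID}^\omega_{-}$ proof of $\Gamma\vdash\Delta$ that contains no instance of $(\mathrm{Subst})$ and uses only inference rules occurring in $\mathrm{Pr}$.
   Context: A substitution (finite map from variables to terms) is atomic if its image contains only variables and constant symbols. Language. Terms are built from variables and function symbols of fixed arity. Predicate symbols: equality $=$, ordinary predicate symbols $Q$, inductive predicate symbols $P$. Formulas: $\phi::=P(\vec t)\mid Q(\vec u)\mid t=u\mid\lnot\phi\mid\phi\vee\phi\mid\phi\wedge\phi\mid\phi\to\phi\mid\exists x.\phi\mid\forall x.\phi$, up to $\alpha$-equivalence. An inductive definition set $\Phi$ is a finite set of productions $\dfrac{Q_1(\vec{u_1}(\vec x))\ \cdots\ Q_n(\vec{u_n}(\vec x))\ P_1(\vec{t_1}(\vec x))\ \cdots\ P_m(\vec{t_m}(\vec x))}{P(\vec t(\vec x))}$. Sequents $\Gamma\vdash\Delta$ have finite sets of formulas on each side. Rules of $\mathrm{CLKID}^\omega$: $(\mathrm{Axiom})$: $\Gamma\vdash\Delta$ if $\Gamma\cap\Delta\neq\emptyset$; $(=\mathrm{R})$: $\Gamma\vdash t=t,\Delta$; $(\mathrm{Wk})$; $(\mathrm{Cut})$; $(\mathrm{Subst})$: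 from $\Gamma\vdash\Delta$ infer $\Gamma[\theta]\vdash\Delta[\theta]$; standard LK rules for $\lnot,\vee,\wedge,\to$; $(\forall\mathrm{L})$, $(\exists\mathrm{R})$ with arbitrary witness term; $(\forall\mathrm{R})$, $(\exists\mathrm{L})$ with fresh eigenvariable; $(=\mathrm{L})$: from $\Gamma[u/x,t/y]\vdash\Delta[u/x,t/y]$ infer $\Gamma[t/x,u/y],t=u\vdash\Delta[t/x,u/y]$; $(\mathrm{UL})$: from $\Gamma,P(\vec u)\vdash\Delta$ one premise per production of $P$, namely $\Gamma,\vec u=\vec t(\vec y),Q_1(\vec{u_1}(\vec y)),\dots,P_m(\vec{t_m}(\vec y))\vdash\Delta$ with $\vec y$ fresh; $(\mathrm{UR})$: for a production, from $\Gamma\vdash Q_i(\vec{u_i}(\vec u)),\Delta$ and $\Gamma\vdash P_j(\vec{t_j}(\vec u)),\Delta$ for all $i,j$ infer $\Gamma\vdash P(\vec t(\vec u)),\Delta$. A pre-proof is a finite derivation tree whose leaves are axiom instances or buds, each bud assigned a companion (an internal node labelled by the identical sequent). Paths follow conclusion-to-premise edges and bud-to-companion edges. A trace along a path $(e_i)$ is a sequence of occurrences $C_i$ of inductive atoms in the antecedents of $e_i$ where: if $e_i$ is the conclusion of $(\mathrm{UL})$ unfolding $C_i$, then $C_{i+1}$ is an inductive atom introduced by that unfolding and $i$ is a progressing point; otherwise $C_{i+1}$ is the occurrence corresponding to $C_i$. A proof is a pre-proof in which every infinite path has a tail with a trace having infinitely many progressing points. *)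

theory Defs
  imports Main
begin

(* Variables are natural numbers. Formulas are in de Bruijn form, a binder binding index 0, so
   that equality is alpha-equivalence: index n below k binders is the free variable n - k. *)

datatype 'f trm = Var nat | Fn 'f "'f trm list"

datatype ('f, 'q, 'p) fm =
    Ind 'p "'f trm list"
  | Ord 'q "'f trm list"
  | Eq "'f trm" "'f trm"
  | Neg "('f, 'q, 'p) fm"
  | Disj "('f, 'q, 'p) fm" "('f, 'q, 'p) fm"
  | Conj "('f, 'q, 'p) fm" "('f, 'q, 'p) fm"
  | Imp "('f, 'q, 'p) fm" "('f, 'q, 'p) fm"
  | Exi "('f, 'q, 'p) fm"
  | Uni "('f, 'q, 'p) fm"

type_synonym ('f, 'q, 'p) sequent = "('f, 'q, 'p) fm set \<times> ('f, 'q, 'p) fm set"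

(* The domains of the arity maps are the symbols of the signature. *)

record ('f, 'q, 'p) signature =
  fun_ar :: "'f \<rightharpoonup> nat"
  ord_ar :: "'q \<rightharpoonup> nat"
  ind_ar :: "'p \<rightharpoonup> nat"

fun wf_trm :: "('f, 'q, 'p) signature \<Rightarrow> 'f trm \<Rightarrow> bool" where
  "wf_trm \<Sigma> (Var x) \<longleftrightarrow> True"
| "wf_trm \<Sigma> (Fn f ts) \<longleftrightarrow> fun_ar \<Sigma> f = Some (length ts) \<and> (\<forall>t\<in>set ts. wf_trm \<Sigma> t)"

fun wf_fm :: "('f, 'q, 'p) signature \<Rightarrow> ('f, 'q, 'p) fm \<Rightarrow> bool" where
  "wf_fm \<Sigma> (Ind p ts) \<longleftrightarrow> ind_ar \<Sigma> p = Some (length ts) \<and> (\<forall>t\<in>set ts. wf_trm \<Sigma> t)"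
| "wf_fm \<Sigma> (Ord q ts) \<longleftrightarrow> ord_ar \<Sigma> q = Some (length ts) \<and> (\<forall>t\<in>set ts. wf_trm \<Sigma> t)"
| "wf_fm \<Sigma> (Eq t u) \<longleftrightarrow> wf_trm \<Sigma> t \<and> wf_trm \<Sigma> u"
| "wf_fm \<Sigma> (Neg A) \<longleftrightarrow> wf_fm \<Sigma> A"
| "wf_fm \<Sigma> (Disj A B) \<longleftrightarrow> wf_fm \<Sigma> A \<and> wf_fm \<Sigma> B"
| "wf_fm \<Sigma> (Conj A B) \<longleftrightarrow> wf_fm \<Sigma> A \<and> wf_fm \<Sigma> B"
| "wf_fm \<Sigma> (Imp A B) \<longleftrightarrow> wf_fm \<Sigma> A \<and> wf_fm \<Sigma> B"
| "wf_fm \<Sigma> (Exi A) \<longleftrightarrow> wf_fm \<Sigma> A"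
| "wf_fm \<Sigma> (Uni A) \<longleftrightarrow> wf_fm \<Sigma> A"

definition wf_sequent :: "('f, 'q, 'p) signature \<Rightarrow> ('f, 'q, 'p) sequent \<Rightarrow> bool" where
  "wf_sequent \<Sigma> S \<longleftrightarrow>
     finite (fst S) \<and> finite (snd S) \<and> (\<forall>A \<in> fst S \<union> snd S. wf_fm \<Sigma> A)"

fun fv_trm :: "'f trm \<Rightarrow> nat set" where
  "fv_trm (Var x) = {x}"
| "fv_trm (Fn f ts) = (\<Union>t\<in>set ts. fv_trm t)"

fun fv :: "('f, 'q, 'p) fm \<Rightarrow> nat set" where
  "fv (Ind p ts) = (\<Union>t\<in>set ts. fv_trm t)"
| "fv (Ord q ts) = (\<Union>t\<in>set ts. fv_trm t)"
| "fv (Eq t u) = fv_trm t \<union> fv_trm u"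
| "fv (Neg A) = fv A"
| "fv (Disj A B) = fv A \<union> fv B"
| "fv (Conj A B) = fv A \<union> fv B"
| "fv (Imp A B) = fv A \<union> fv B"
| "fv (Exi A) = {n. Suc n \<in> fv A}"
| "fv (Uni A) = {n. Suc n \<in> fv A}"

definition fv_sequent :: "('f, 'q, 'p) sequent \<Rightarrow> nat set" where
  "fv_sequent S = (\<Union>A \<in> fst S \<union> snd S. fv A)"

type_synonym 'f sub = "nat \<Rightarrow> 'f trm"

fun subst_trm :: "'f sub \<Rightarrow> 'f trm \<Rightarrow> 'f trm" where
  "subst_trm \<sigma> (Var x) = \<sigma> x"
| "subst_trm \<sigma> (Fn f ts) = Fn f (map (subst_trm \<sigma>) ts)"

definition up :: "'f sub \<Rightarrow> 'f sub" where
  "up \<sigma> = case_nat (Var 0) (\<lambda>n. subst_trm (\<lambda>x. Var (Suc x)) (\<sigma> n))"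

fun subst :: "'f sub \<Rightarrow> ('f, 'q, 'p) fm \<Rightarrow> ('f, 'q, 'p) fm" where
  "subst \<sigma> (Ind p ts) = Ind p (map (subst_trm \<sigma>) ts)"
| "subst \<sigma> (Ord q ts) = Ord q (map (subst_trm \<sigma>) ts)"
| "subst \<sigma> (Eq t u) = Eq (subst_trm \<sigma> t) (subst_trm \<sigma> u)"
| "subst \<sigma> (Neg A) = Neg (subst \<sigma> A)"
| "subst \<sigma> (Disj A B) = Disj (subst \<sigma> A) (subst \<sigma> B)"
| "subst \<sigma> (Conj A B) = Conj (subst \<sigma> A) (subst \<sigma> B)"
| "subst \<sigma> (Imp A B) = Imp (subst \<sigma> A) (subst \<sigma> B)"
| "subst \<sigma> (Exi A) = Exi (subst (up \<sigma>) A)"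
| "subst \<sigma> (Uni A) = Uni (subst (up \<sigma>) A)"

(* The body A of a quantifier with its bound variable replaced by t. *)

definition inst :: "('f, 'q, 'p) fm \<Rightarrow> 'f trm \<Rightarrow> ('f, 'q, 'p) fm" where
  "inst A t = subst (case_nat t Var) A"

(* A finite map from variables to terms is extended by the identity outside its domain. *)

definition substitution :: "('f, 'q, 'p) signature \<Rightarrow> 'f sub \<Rightarrow> bool" where
  "substitution \<Sigma> \<theta> \<longleftrightarrow> finite {x. \<theta> x \<noteq> Var x} \<and> (\<forall>x. wf_trm \<Sigma> (\<theta> x))"

definition atomic :: "'f sub \<Rightarrow> bool" where
  "atomic \<theta> \<longleftrightarrow> (\<forall>x. (\<exists>y. \<theta> x = Var y) \<or> (\<exists>c. \<theta> x = Fn c []))"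

definition sub2 :: "nat \<Rightarrow> 'f trm \<Rightarrow> nat \<Rightarrow> 'f trm \<Rightarrow> 'f sub" where
  "sub2 x t y u = Var(x := t, y := u)"

datatype ('f, 'q, 'p) production = Production
  (ord_prems: "('q \<times> 'f trm list) list")
  (ind_prems: "('p \<times> 'f trm list) list")
  (head_pred: 'p)
  (head_args: "'f trm list")

definition ord_prem_fms :: "'f sub \<Rightarrow> ('f, 'q, 'p) production \<Rightarrow> ('f, 'q, 'p) fm list" where
  "ord_prem_fms \<sigma> r = map (\<lambda>(q, ts). subst \<sigma> (Ord q ts)) (ord_prems r)"

definition ind_prem_fms :: "'f sub \<Rightarrow> ('f, 'q, 'p) production \<Rightarrow> ('f, 'q, 'p) fm list" where
  "ind_prem_fms \<sigma> r = map (\<lambda>(p, ts). subst \<sigma> (Ind p ts)) (ind_prems r)"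

definition head_fm :: "'f sub \<Rightarrow> ('f, 'q, 'p) production \<Rightarrow> ('f, 'q, 'p) fm" where
  "head_fm \<sigma> r = subst \<sigma> (Ind (head_pred r) (head_args r))"

definition production_fms :: "('f, 'q, 'p) production \<Rightarrow> ('f, 'q, 'p) fm set" where
  "production_fms r =
     insert (head_fm Var r) (set (ord_prem_fms Var r) \<union> set (ind_prem_fms Var r))"

definition production_vars :: "('f, 'q, 'p) production \<Rightarrow> nat set" where
  "production_vars r = (\<Union>A\<in>production_fms r. fv A)"

definition inductive_definition_set ::
    "('f, 'q, 'p) signature \<Rightarrow> ('f, 'q, 'p) production set \<Rightarrow> bool" where
  "inductive_definition_set \<Sigma> \<Phi> \<longleftrightarrow>
     finite \<Phi> \<and> (\<forall>r\<in>\<Phi>. \<forall>A\<in>production_fms r. wf_fm \<Sigma> A)"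

datatype rule =
    R_Axiom | R_EqR | R_Wk | R_Cut | R_Subst
  | R_NegL | R_NegR | R_DisjL | R_DisjR | R_ConjL | R_ConjR | R_ImpL | R_ImpR
  | R_UniL | R_UniR | R_ExiL | R_ExiR | R_EqL | R_UL | R_UR

(* Rule instances. The first two arguments are the contexts Gamma and Delta of the rule schema,
   those of the premise in the case of Wk, Subst and EqL. In UL, the list pairs each production
   of the unfolded predicate with the renaming of its variables to the fresh variables. *)

datatype ('f, 'q, 'p) rule_inst =
    Axiom "('f, 'q, 'p) fm set" "('f, 'q, 'p) fm set"
  | EqR "('f, 'q, 'p) fm set" "('f, 'q, 'p) fm set" "'f trm"
  | Wk "('f, 'q, 'p) fm set" "('f, 'q, 'p) fm set" "('f, 'q, 'p) fm set" "('f, 'q, 'p) fm set"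
  | Cut "('f, 'q, 'p) fm set" "('f, 'q, 'p) fm set" "('f, 'q, 'p) fm"
  | Subst "('f, 'q, 'p) fm set" "('f, 'q, 'p) fm set" "'f sub"
  | NegL "('f, 'q, 'p) fm set" "('f, 'q, 'p) fm set" "('f, 'q, 'p) fm"
  | NegR "('f, 'q, 'p) fm set" "('f, 'q, 'p) fm set" "('f, 'q, 'p) fm"
  | DisjL "('f, 'q, 'p) fm set" "('f, 'q, 'p) fm set" "('f, 'q, 'p) fm" "('f, 'q, 'p) fm"
  | DisjR "('f, 'q, 'p) fm set" "('f, 'q, 'p) fm set" "('f, 'q, 'p) fm" "('f, 'q, 'p) fm"
  | ConjL "('f, 'q, 'p) fm set" "('f, 'q, 'p) fm set" "('f, 'q, 'p) fm" "('f, 'q, 'p) fm"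
  | ConjR "('f, 'q, 'p) fm set" "('f, 'q, 'p) fm set" "('f, 'q, 'p) fm" "('f, 'q, 'p) fm"
  | ImpL "('f, 'q, 'p) fm set" "('f, 'q, 'p) fm set" "('f, 'q, 'p) fm" "('f, 'q, 'p) fm"
  | ImpR "('f, 'q, 'p) fm set" "('f, 'q, 'p) fm set" "('f, 'q, 'p) fm" "('f, 'q, 'p) fm"
  | UniL "('f, 'q, 'p) fm set" "('f, 'q, 'p) fm set" "('f, 'q, 'p) fm" "'f trm"
  | UniR "('f, 'q, 'p) fm set" "('f, 'q, 'p) fm set" "('f, 'q, 'p) fm" nat
  | ExiL "('f, 'q, 'p) fm set" "('f, 'q, 'p) fm set" "('f, 'q, 'p) fm" nat
  | ExiR "('f, 'q, 'p) fm set" "('f, 'q, 'p) fm set" "('f, 'q, 'p) fm" "'f trm"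
  | EqL "('f, 'q, 'p) fm set" "('f, 'q, 'p) fm set" "'f trm" "'f trm" nat nat
  | UL "('f, 'q, 'p) fm set" "('f, 'q, 'p) fm set" 'p "'f trm list"
      "(('f, 'q, 'p) production \<times> (nat \<Rightarrow> nat)) list"
  | UR "('f, 'q, 'p) fm set" "('f, 'q, 'p) fm set" "('f, 'q, 'p) production" "'f sub"

fun rule_of :: "('f, 'q, 'p) rule_inst \<Rightarrow> rule" where
  "rule_of (Axiom \<Gamma> \<Delta>) = R_Axiom"
| "rule_of (EqR \<Gamma> \<Delta> t) = R_EqR"
| "rule_of (Wk \<Gamma> \<Delta> \<Gamma>' \<Delta>') = R_Wk"
| "rule_of (Cut \<Gamma> \<Delta> A) = R_Cut"
| "rule_of (Subst \<Gamma> \<Delta> \<theta>) = R_Subst"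
| "rule_of (NegL \<Gamma> \<Delta> A) = R_NegL"
| "rule_of (NegR \<Gamma> \<Delta> A) = R_NegR"
| "rule_of (DisjL \<Gamma> \<Delta> A B) = R_DisjL"
| "rule_of (DisjR \<Gamma> \<Delta> A B) = R_DisjR"
| "rule_of (ConjL \<Gamma> \<Delta> A B) = R_ConjL"
| "rule_of (ConjR \<Gamma> \<Delta> A B) = R_ConjR"
| "rule_of (ImpL \<Gamma> \<Delta> A B) = R_ImpL"
| "rule_of (ImpR \<Gamma> \<Delta> A B) = R_ImpR"
| "rule_of (UniL \<Gamma> \<Delta> A t) = R_UniL"
| "rule_of (UniR \<Gamma> \<Delta> A x) = R_UniR"
| "rule_of (ExiL \<Gamma> \<Delta> A x) = R_ExiL"
| "rule_of (ExiR \<Gamma> \<Delta> A t) = R_ExiR"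
| "rule_of (EqL \<Gamma> \<Delta> t u x y) = R_EqL"
| "rule_of (UL \<Gamma> \<Delta> p us bs) = R_UL"
| "rule_of (UR \<Gamma> \<Delta> r \<sigma>) = R_UR"

fun concl :: "('f, 'q, 'p) rule_inst \<Rightarrow> ('f, 'q, 'p) sequent" where
  "concl (Axiom \<Gamma> \<Delta>) = (\<Gamma>, \<Delta>)"
| "concl (EqR \<Gamma> \<Delta> t) = (\<Gamma>, insert (Eq t t) \<Delta>)"
| "concl (Wk \<Gamma> \<Delta> \<Gamma>' \<Delta>') = (\<Gamma>', \<Delta>')"
| "concl (Cut \<Gamma> \<Delta> A) = (\<Gamma>, \<Delta>)"
| "concl (Subst \<Gamma> \<Delta> \<theta>) = (subst \<theta> ` \<Gamma>, subst \<theta> ` \<Delta>)"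
| "concl (NegL \<Gamma> \<Delta> A) = (insert (Neg A) \<Gamma>, \<Delta>)"
| "concl (NegR \<Gamma> \<Delta> A) = (\<Gamma>, insert (Neg A) \<Delta>)"
| "concl (DisjL \<Gamma> \<Delta> A B) = (insert (Disj A B) \<Gamma>, \<Delta>)"
| "concl (DisjR \<Gamma> \<Delta> A B) = (\<Gamma>, insert (Disj A B) \<Delta>)"
| "concl (ConjL \<Gamma> \<Delta> A B) = (insert (Conj A B) \<Gamma>, \<Delta>)"
| "concl (ConjR \<Gamma> \<Delta> A B) = (\<Gamma>, insert (Conj A B) \<Delta>)"
| "concl (ImpL \<Gamma> \<Delta> A B) = (insert (Imp A B) \<Gamma>, \<Delta>)"
| "concl (ImpR \<Gamma> \<Delta> A B) = (\<Gamma>, insert (Imp A B) \<Delta>)"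
| "concl (UniL \<Gamma> \<Delta> A t) = (insert (Uni A) \<Gamma>, \<Delta>)"
| "concl (UniR \<Gamma> \<Delta> A x) = (\<Gamma>, insert (Uni A) \<Delta>)"
| "concl (ExiL \<Gamma> \<Delta> A x) = (insert (Exi A) \<Gamma>, \<Delta>)"
| "concl (ExiR \<Gamma> \<Delta> A t) = (\<Gamma>, insert (Exi A) \<Delta>)"
| "concl (EqL \<Gamma> \<Delta> t u x y) =
     (insert (Eq t u) (subst (sub2 x t y u) ` \<Gamma>), subst (sub2 x t y u) ` \<Delta>)"
| "concl (UL \<Gamma> \<Delta> p us bs) = (insert (Ind p us) \<Gamma>, \<Delta>)"
| "concl (UR \<Gamma> \<Delta> r \<sigma>) = (\<Gamma>, insert (head_fm \<sigma> r) \<Delta>)"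

definition case_descendants ::
    "('f, 'q, 'p) production \<times> (nat \<Rightarrow> nat) \<Rightarrow> ('f, 'q, 'p) fm set" where
  "case_descendants b = set (ind_prem_fms (\<lambda>x. Var (snd b x)) (fst b))"

definition case_fms ::
    "'f trm list \<Rightarrow> ('f, 'q, 'p) production \<times> (nat \<Rightarrow> nat) \<Rightarrow> ('f, 'q, 'p) fm set" where
  "case_fms us b =
     (let \<rho> = (\<lambda>x. Var (snd b x)) in
       set (map2 Eq us (map (subst_trm \<rho>) (head_args (fst b)))) \<union>
       set (ord_prem_fms \<rho> (fst b)) \<union> case_descendants b)"

fun prems :: "('f, 'q, 'p) rule_inst \<Rightarrow> ('f, 'q, 'p) sequent list" where
  "prems (Axiom \<Gamma> \<Delta>) = []"
| "prems (EqR \<Gamma> \<Delta> t) = []"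
| "prems (Wk \<Gamma> \<Delta> \<Gamma>' \<Delta>') = [(\<Gamma>, \<Delta>)]"
| "prems (Cut \<Gamma> \<Delta> A) = [(\<Gamma>, insert A \<Delta>), (insert A \<Gamma>, \<Delta>)]"
| "prems (Subst \<Gamma> \<Delta> \<theta>) = [(\<Gamma>, \<Delta>)]"
| "prems (NegL \<Gamma> \<Delta> A) = [(\<Gamma>, insert A \<Delta>)]"
| "prems (NegR \<Gamma> \<Delta> A) = [(insert A \<Gamma>, \<Delta>)]"
| "prems (DisjL \<Gamma> \<Delta> A B) = [(insert A \<Gamma>, \<Delta>), (insert B \<Gamma>, \<Delta>)]"
| "prems (DisjR \<Gamma> \<Delta> A B) = [(\<Gamma>, insert A (insert B \<Delta>))]"
| "prems (ConjL \<Gamma> \<Delta> A B) = [(insert A (insert B \<Gamma>), \<Delta>)]"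
| "prems (ConjR \<Gamma> \<Delta> A B) = [(\<Gamma>, insert A \<Delta>), (\<Gamma>, insert B \<Delta>)]"
| "prems (ImpL \<Gamma> \<Delta> A B) = [(\<Gamma>, insert A \<Delta>), (insert B \<Gamma>, \<Delta>)]"
| "prems (ImpR \<Gamma> \<Delta> A B) = [(insert A \<Gamma>, insert B \<Delta>)]"
| "prems (UniL \<Gamma> \<Delta> A t) = [(insert (inst A t) \<Gamma>, \<Delta>)]"
| "prems (UniR \<Gamma> \<Delta> A x) = [(\<Gamma>, insert (inst A (Var x)) \<Delta>)]"
| "prems (ExiL \<Gamma> \<Delta> A x) = [(insert (inst A (Var x)) \<Gamma>, \<Delta>)]"
| "prems (ExiR \<Gamma> \<Delta> A t) = [(\<Gamma>, insert (inst A t) \<Delta>)]"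
| "prems (EqL \<Gamma> \<Delta> t u x y) =
     [(subst (sub2 x u y t) ` \<Gamma>, subst (sub2 x u y t) ` \<Delta>)]"
| "prems (UL \<Gamma> \<Delta> p us bs) = map (\<lambda>b. (\<Gamma> \<union> case_fms us b, \<Delta>)) bs"
| "prems (UR \<Gamma> \<Delta> r \<sigma>) =
     map (\<lambda>A. (\<Gamma>, insert A \<Delta>)) (ord_prem_fms \<sigma> r @ ind_prem_fms \<sigma> r)"

fun side_condition ::
    "('f, 'q, 'p) signature \<Rightarrow> ('f, 'q, 'p) production set \<Rightarrow> ('f, 'q, 'p) rule_inst \<Rightarrow> bool"
where
  "side_condition \<Sigma> \<Phi> (Axiom \<Gamma> \<Delta>) \<longleftrightarrow> \<Gamma> \<inter> \<Delta> \<noteq> {}"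
| "side_condition \<Sigma> \<Phi> (Wk \<Gamma> \<Delta> \<Gamma>' \<Delta>') \<longleftrightarrow> \<Gamma> \<subseteq> \<Gamma>' \<and> \<Delta> \<subseteq> \<Delta>'"
| "side_condition \<Sigma> \<Phi> (Subst \<Gamma> \<Delta> \<theta>) \<longleftrightarrow> substitution \<Sigma> \<theta>"
| "side_condition \<Sigma> \<Phi> (UniL \<Gamma> \<Delta> A t) \<longleftrightarrow> wf_trm \<Sigma> t"
| "side_condition \<Sigma> \<Phi> (UniR \<Gamma> \<Delta> A x) \<longleftrightarrow> x \<notin> fv_sequent (concl (UniR \<Gamma> \<Delta> A x))"
| "side_condition \<Sigma> \<Phi> (ExiL \<Gamma> \<Delta> A x) \<longleftrightarrow> x \<notin> fv_sequent (concl (ExiL \<Gamma> \<Delta> A x))"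
| "side_condition \<Sigma> \<Phi> (ExiR \<Gamma> \<Delta> A t) \<longleftrightarrow> wf_trm \<Sigma> t"
| "side_condition \<Sigma> \<Phi> (EqL \<Gamma> \<Delta> t u x y) \<longleftrightarrow>
     x \<noteq> y \<and> wf_trm \<Sigma> t \<and> wf_trm \<Sigma> u \<and> wf_sequent \<Sigma> (\<Gamma>, \<Delta>)"
| "side_condition \<Sigma> \<Phi> (UL \<Gamma> \<Delta> p us bs) \<longleftrightarrow>
     distinct (map fst bs) \<and> set (map fst bs) = {r\<in>\<Phi>. head_pred r = p} \<and>
     (\<forall>(r, \<rho>)\<in>set bs. inj_on \<rho> (production_vars r) \<and>
        \<rho> ` production_vars r \<inter> fv_sequent (concl (UL \<Gamma> \<Delta> p us bs)) = {})"
| "side_condition \<Sigma> \<Phi> (UR \<Gamma> \<Delta> r \<sigma>) \<longleftrightarrow>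
     r \<in> \<Phi> \<and> (\<forall>x\<in>production_vars r. wf_trm \<Sigma> (\<sigma> x))"
| "side_condition \<Sigma> \<Phi> _ \<longleftrightarrow> True"

definition valid_inst ::
    "('f, 'q, 'p) signature \<Rightarrow> ('f, 'q, 'p) production set \<Rightarrow> ('f, 'q, 'p) rule_inst \<Rightarrow> bool"
where
  "valid_inst \<Sigma> \<Phi> R \<longleftrightarrow>
     side_condition \<Sigma> \<Phi> R \<and> (\<forall>S\<in>insert (concl R) (set (prems R)). wf_sequent \<Sigma> S)"

(* Nodes are addressed by lists of child numbers; a bud carries the address, in the whole tree,
   of its companion. *)

datatype ('f, 'q, 'p) deriv_tree =
    Bud "('f, 'q, 'p) sequent" "nat list"
  | Inf "('f, 'q, 'p) rule_inst" "('f, 'q, 'p) deriv_tree list"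

fun root_sequent :: "('f, 'q, 'p) deriv_tree \<Rightarrow> ('f, 'q, 'p) sequent" where
  "root_sequent (Bud S c) = S"
| "root_sequent (Inf R ds) = concl R"

fun rule_insts :: "('f, 'q, 'p) deriv_tree \<Rightarrow> ('f, 'q, 'p) rule_inst set" where
  "rule_insts (Bud S c) = {}"
| "rule_insts (Inf R ds) = insert R (\<Union>d\<in>set ds. rule_insts d)"

definition rules_used :: "('f, 'q, 'p) deriv_tree \<Rightarrow> rule set" where
  "rules_used D = rule_of ` rule_insts D"

fun subtree :: "('f, 'q, 'p) deriv_tree \<Rightarrow> nat list \<Rightarrow> ('f, 'q, 'p) deriv_tree option" where
  "subtree D [] = Some D"
| "subtree (Inf R ds) (j # a) = (if j < length ds then subtree (ds ! j) a else None)"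
| "subtree (Bud S c) (j # a) = None"

definition pre_proof ::
    "('f, 'q, 'p) signature \<Rightarrow> ('f, 'q, 'p) production set \<Rightarrow> ('f, 'q, 'p) deriv_tree \<Rightarrow> bool"
where
  "pre_proof \<Sigma> \<Phi> D \<longleftrightarrow>
     (\<forall>a R ds. subtree D a = Some (Inf R ds) \<longrightarrow>
        valid_inst \<Sigma> \<Phi> R \<and> map root_sequent ds = prems R) \<and>
     (\<forall>a S c. subtree D a = Some (Bud S c) \<longrightarrow>
        (\<exists>R ds. subtree D c = Some (Inf R ds) \<and> ds \<noteq> [] \<and> concl R = S))"

definition edge :: "('f, 'q, 'p) deriv_tree \<Rightarrow> nat list \<Rightarrow> nat list \<Rightarrow> bool" where
  "edge D a b \<longleftrightarrow>
     (case subtree D a of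
        None \<Rightarrow> False
      | Some (Bud S c) \<Rightarrow> b = c
      | Some (Inf R ds) \<Rightarrow> (\<exists>j<length ds. b = a @ [j]))"

definition infinite_path :: "('f, 'q, 'p) deriv_tree \<Rightarrow> (nat \<Rightarrow> nat list) \<Rightarrow> bool" where
  "infinite_path D e \<longleftrightarrow> (\<forall>i. edge D (e i) (e (Suc i)))"

(* C in the conclusion is unfolded and C' is one of the inductive atoms that the unfolding
   introduces in premise j. *)

fun progress_step ::
    "('f, 'q, 'p) rule_inst \<Rightarrow> nat \<Rightarrow> ('f, 'q, 'p) fm \<Rightarrow> ('f, 'q, 'p) fm \<Rightarrow> bool" where
  "progress_step (UL \<Gamma> \<Delta> p us bs) j C C' \<longleftrightarrow> C = Ind p us \<and> C' \<in> case_descendants (bs ! j)"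
| "progress_step _ _ _ _ \<longleftrightarrow> False"

(* The inductive atom C' in the antecedent of premise j corresponds to C in that of the
   conclusion. Inductive atoms are never principal on the left except in UL, where the unfolded
   atom may in addition occur in the context. *)

fun trace_step ::
    "('f, 'q, 'p) rule_inst \<Rightarrow> nat \<Rightarrow> ('f, 'q, 'p) fm \<Rightarrow> ('f, 'q, 'p) fm \<Rightarrow> bool" where
  "trace_step (Subst \<Gamma> \<Delta> \<theta>) j C C' \<longleftrightarrow> C = subst \<theta> C'"
| "trace_step (EqL \<Gamma> \<Delta> t u x y) j C C' \<longleftrightarrow>
     (\<exists>F\<in>\<Gamma>. C = subst (sub2 x t y u) F \<and> C' = subst (sub2 x u y t) F)"
| "trace_step (UL \<Gamma> \<Delta> p us bs) j C C' \<longleftrightarrow>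
     C \<in> \<Gamma> \<and> C' = C \<or> progress_step (UL \<Gamma> \<Delta> p us bs) j C C'"
| "trace_step _ j C C' \<longleftrightarrow> C' = C"

definition inductive_atom :: "('f, 'q, 'p) fm \<Rightarrow> bool" where
  "inductive_atom C \<longleftrightarrow> (\<exists>p ts. C = Ind p ts)"

definition trace ::
    "('f, 'q, 'p) deriv_tree \<Rightarrow> (nat \<Rightarrow> nat list) \<Rightarrow> (nat \<Rightarrow> ('f, 'q, 'p) fm) \<Rightarrow> bool" where
  "trace D e C \<longleftrightarrow>
     (\<forall>i. inductive_atom (C i) \<and>
        (\<exists>d. subtree D (e i) = Some d \<and> C i \<in> fst (root_sequent d) \<and>
           (case d of
              Bud S c \<Rightarrow> C (Suc i) = C i
            | Inf R ds \<Rightarrow> trace_step R (last (e (Suc i))) (C i) (C (Suc i)))))"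

definition progressing_point ::
    "('f, 'q, 'p) deriv_tree \<Rightarrow> (nat \<Rightarrow> nat list) \<Rightarrow> (nat \<Rightarrow> ('f, 'q, 'p) fm) \<Rightarrow> nat \<Rightarrow> bool"
where
  "progressing_point D e C i \<longleftrightarrow>
     (\<exists>R ds. subtree D (e i) = Some (Inf R ds) \<and>
        progress_step R (last (e (Suc i))) (C i) (C (Suc i)))"

definition global_trace_condition :: "('f, 'q, 'p) deriv_tree \<Rightarrow> bool" where
  "global_trace_condition D \<longleftrightarrow>
     (\<forall>e. infinite_path D e \<longrightarrow>
        (\<exists>k C. trace D (\<lambda>i. e (k + i)) C \<and>
           infinite {i. progressing_point D (\<lambda>i. e (k + i)) C i}))"

definition clkid_omega_proof ::
    "('f, 'q, 'p) signature \<Rightarrow> ('f, 'q, 'p) production set \<Rightarrow> ('f, 'q, 'p) deriv_tree \<Rightarrow> bool"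
where
  "clkid_omega_proof \<Sigma> \<Phi> D \<longleftrightarrow> pre_proof \<Sigma> \<Phi> D \<and> global_trace_condition D"

definition clkid_omega_minus_proof ::
    "('f, 'q, 'p) signature \<Rightarrow> ('f, 'q, 'p) production set \<Rightarrow> ('f, 'q, 'p) deriv_tree \<Rightarrow> bool"
where
  "clkid_omega_minus_proof \<Sigma> \<Phi> D \<longleftrightarrow> clkid_omega_proof \<Sigma> \<Phi> D \<and> R_Cut \<notin> rules_used D"

end

theory Submission imports Defs begin

text \<open>
  Every instance of \<open>Subst\<close> is removed by pushing its substitution towards the leaves, so that the
  new derivation visits pairs of an address in the old proof and a pending substitution. Since the
  substitutions are atomic, the pending ones compose to maps from the finitely many variables of
  the proof to variables and constants. If eigenvariables are renamed to variables below a fixed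
  bound (twice the number of variables suffices to find fresh ones), only finitely many pairs
  occur, and the derivation can be folded back into a finite tree with buds. Buds and instances of
  \<open>Subst\<close> leave no node in the unfolding; a path through them alone would violate the trace
  condition, so such stretches are finite. Traces carry over by applying the pending substitution.
\<close>

section \<open>Substitution\<close>

text \<open>Atomicity is what keeps the construction finite: an instance of \<open>Subst\<close>
  with x mapped to f(x) on a cycle would make the pending substitutions grow without bound. An
  atomic \<open>\<sigma>\<close> sends an old variable to an old variable or a constant, and
  composition applies \<open>\<sigma>\<close> before the pending \<open>\<theta>\<close>, so a
  composite takes no values beyond those of \<open>\<theta>\<close> and the constants of the proof.
  Two ranges of variables are kept apart: \<open>N\<close> bounds the variables of the old proof, on
  which pending substitutions act, and \<open>2 * N\<close> bounds the variables in their values.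
  Fresh names are a function of \<open>N\<close> and \<open>\<theta>\<close> alone. Hence the pair
  at a premise is determined by the pair at the conclusion, and the pairs form a deterministic
  finite graph. A new bud needs a repeated pair and not only a repeated address, so a cycle of the
  new tree may run through a cycle of the old proof several times with different substitutions. The
  trace condition is therefore transferred path by path, by expanding a new path to an old
  one.\<close>

lemma subst_trm_cong: "(\<And>x. x \<in> fv_trm t \<Longrightarrow> \<sigma> x = \<tau> x) \<Longrightarrow> subst_trm \<sigma> t = subst_trm \<tau> t"
  by (induction t) auto

lemma subst_trm_Var [simp]: "subst_trm Var t = t"
  by (induction t) (auto intro: map_idI)

lemma subst_trm_subst_trm:
  "subst_trm \<theta> (subst_trm \<sigma> t) = subst_trm (\<lambda>x. subst_trm \<theta> (\<sigma> x)) t"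
  by (induction t) auto

lemma fv_subst_trm: "fv_trm (subst_trm \<theta> t) = (\<Union>x\<in>fv_trm t. fv_trm (\<theta> x))"
  by (induction t) auto

lemma wf_subst_trm: "wf_trm \<Sigma> t \<Longrightarrow> (\<And>x. x \<in> fv_trm t \<Longrightarrow> wf_trm \<Sigma> (\<theta> x)) \<Longrightarrow> wf_trm \<Sigma> (subst_trm \<theta> t)"
  by (induction t) auto

lemma finite_fv_trm [simp]: "finite (fv_trm t)"
  by (induction t) auto

lemma up_simps [simp]:
  "up \<sigma> 0 = Var 0"
  "up \<sigma> (Suc n) = subst_trm (\<lambda>x. Var (Suc x)) (\<sigma> n)"
  by (simp_all add: up_def)

lemma up_Var [simp]: "up Var = Var"
  by (rule ext) (simp add: up_def split: nat.split)

lemma up_comp: "subst_trm (up \<theta>) (up \<sigma> x) = up (\<lambda>x. subst_trm \<theta> (\<sigma> x)) x"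
  by (cases x) (simp_all add: subst_trm_subst_trm)

lemma subst_cong: "(\<And>x. x \<in> fv A \<Longrightarrow> \<sigma> x = \<tau> x) \<Longrightarrow> subst \<sigma> A = subst \<tau> A"
proof (induction A arbitrary: \<sigma> \<tau>)
  case (Ind p ts)
  then have "subst_trm \<sigma> t = subst_trm \<tau> t" if "t \<in> set ts" for t
    using that by (intro subst_trm_cong) auto
  then show ?case by simp
next
  case (Ord q ts)
  then have "subst_trm \<sigma> t = subst_trm \<tau> t" if "t \<in> set ts" for t
    using that by (intro subst_trm_cong) auto
  then show ?case by simp
next
  case (Eq t u)
  then show ?case by (simp add: subst_trm_cong[of t \<sigma> \<tau>] subst_trm_cong[of u \<sigma> \<tau>])
next
  case (Neg A)
  show ?case using Neg.IH[OF Neg.prems] by simp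
next
  case (Disj A B)
  show ?case using Disj.IH(1,2)[OF Disj.prems] by simp
next
  case (Conj A B)
  show ?case using Conj.IH(1,2)[OF Conj.prems] by simp
next
  case (Imp A B)
  show ?case using Imp.IH(1,2)[OF Imp.prems] by simp
next
  case (Exi A)
  have "up \<sigma> x = up \<tau> x" if "x \<in> fv A" for x
    using that by (cases x) (simp_all add: Exi.prems)
  then show ?case by (simp add: Exi.IH[of "up \<sigma>" "up \<tau>"])
next
  case (Uni A)
  have "up \<sigma> x = up \<tau> x" if "x \<in> fv A" for x
    using that by (cases x) (simp_all add: Uni.prems)
  then show ?case by (simp add: Uni.IH[of "up \<sigma>" "up \<tau>"])
qed

lemma subst_Var [simp]: "subst Var A = A"
  by (induction A) (auto intro: map_idI)

lemma subst_subst: "subst \<theta> (subst \<sigma> A) = subst (\<lambda>x. subst_trm \<theta> (\<sigma> x)) A"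
  by (induction A arbitrary: \<theta> \<sigma>) (auto simp: subst_trm_subst_trm up_comp)

lemma fv_subst: "fv (subst \<theta> A) = (\<Union>x\<in>fv A. fv_trm (\<theta> x))"
proof (induction A arbitrary: \<theta>)
  case (Exi A)
  \<comment> \<open>\<open>up \<theta>\<close> fixes index 0 and shifts all other values, so a
    nonzero index can only come from a shifted value.\<close>
  have "Suc n \<in> fv_trm (up \<theta> x) \<longleftrightarrow> (\<exists>y. x = Suc y \<and> n \<in> fv_trm (\<theta> y))" for n x
    by (cases x) (auto simp: fv_subst_trm)
  then show ?case using Exi by auto
next
  case (Uni A)
  have "Suc n \<in> fv_trm (up \<theta> x) \<longleftrightarrow> (\<exists>y. x = Suc y \<and> n \<in> fv_trm (\<theta> y))" for n x
    by (cases x) (auto simp: fv_subst_trm)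
  then show ?case using Uni by auto
qed (auto simp: fv_subst_trm)

lemma wf_subst: "wf_fm \<Sigma> A \<Longrightarrow> (\<And>x. x \<in> fv A \<Longrightarrow> wf_trm \<Sigma> (\<theta> x)) \<Longrightarrow> wf_fm \<Sigma> (subst \<theta> A)"
proof (induction A arbitrary: \<theta>)
  case (Exi A)
  have "wf_trm \<Sigma> (up \<theta> x)" if "x \<in> fv A" for x
    using that Exi.prems by (cases x) (auto intro!: wf_subst_trm)
  then show ?case using Exi by simp
next
  case (Uni A)
  have "wf_trm \<Sigma> (up \<theta> x)" if "x \<in> fv A" for x
    using that Uni.prems by (cases x) (auto intro!: wf_subst_trm)
  then show ?case using Uni by simp
qed (auto intro!: wf_subst_trm)

lemma finite_fv [simp]: "finite (fv A)"
proof (induction A)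
  case (Exi A)
  then show ?case using finite_vimageI[of "fv A" Suc] by (simp add: vimage_def)
next
  case (Uni A)
  then show ?case using finite_vimageI[of "fv A" Suc] by (simp add: vimage_def)
qed auto

text \<open>Makes the quantifier rules stable under substitution: the substituted body, instantiated
  with the substituted witness, is the substituted premise formula.\<close>

lemma subst_inst: "subst \<theta> (inst A t) = inst (subst (up \<theta>) A) (subst_trm \<theta> t)"
proof -
  have "subst_trm \<theta> (case_nat t Var x) = subst_trm (case_nat (subst_trm \<theta> t) Var) (up \<theta> x)" for x
    by (cases x) (simp_all add: subst_trm_subst_trm)
  then show ?thesis by (simp add: inst_def subst_subst)
qed

section \<open>Substitution in sequents and productions\<close>

definition subst_sequent :: "'f sub \<Rightarrow> ('f, 'q, 'p) sequent \<Rightarrow> ('f, 'q, 'p) sequent" where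
  "subst_sequent \<theta> S = (subst \<theta> ` fst S, subst \<theta> ` snd S)"

lemma fst_subst_sequent [simp]: "fst (subst_sequent \<theta> S) = subst \<theta> ` fst S"
  by (simp add: subst_sequent_def)

lemma subst_sequent_Var [simp]: "subst_sequent Var S = S"
  by (simp add: subst_sequent_def)

lemma fv_subst_sequent: "fv_sequent (subst_sequent \<theta> S) = (\<Union>x\<in>fv_sequent S. fv_trm (\<theta> x))"
  by (auto simp: fv_sequent_def subst_sequent_def fv_subst)

lemma wf_subst_sequent:
  "wf_sequent \<Sigma> S \<Longrightarrow> (\<And>x. wf_trm \<Sigma> (\<theta> x)) \<Longrightarrow> wf_sequent \<Sigma> (subst_sequent \<theta> S)"
  by (auto simp: wf_sequent_def subst_sequent_def intro!: wf_subst)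

lemma finite_fv_sequent: "wf_sequent \<Sigma> S \<Longrightarrow> finite (fv_sequent S)"
  by (auto simp: wf_sequent_def fv_sequent_def)

lemma ord_prem_fms_subst:
  "map (subst \<theta>) (ord_prem_fms \<sigma> r) = ord_prem_fms (\<lambda>x. subst_trm \<theta> (\<sigma> x)) r"
  by (auto simp: ord_prem_fms_def subst_trm_subst_trm)

lemma ind_prem_fms_subst:
  "map (subst \<theta>) (ind_prem_fms \<sigma> r) = ind_prem_fms (\<lambda>x. subst_trm \<theta> (\<sigma> x)) r"
  by (auto simp: ind_prem_fms_def subst_trm_subst_trm)

lemma head_fm_subst: "subst \<theta> (head_fm \<sigma> r) = head_fm (\<lambda>x. subst_trm \<theta> (\<sigma> x)) r"
  by (simp add: head_fm_def subst_trm_subst_trm)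

text \<open>Agreement on \<open>production_vars r\<close> is all that is available later: a
  refreshed substitution after a renaming \<open>\<rho>\<close> is known only at the images of these
  variables.\<close>

lemma ord_prem_fms_cong:
  fixes r :: "('f, 'q, 'p) production"
  assumes "\<And>x. x \<in> production_vars r \<Longrightarrow> \<sigma> x = \<tau> x"
  shows "ord_prem_fms \<sigma> r = ord_prem_fms \<tau> r"
proof -
  have "subst \<sigma> (Ord q ts :: ('f, 'q, 'p) fm) = subst \<tau> (Ord q ts)" if "(q, ts) \<in> set (ord_prems r)" for q ts
  proof (rule subst_cong)
    fix x assume "x \<in> fv (Ord q ts :: ('f, 'q, 'p) fm)"
    then show "\<sigma> x = \<tau> x"
      using that by (intro assms) (force simp: production_vars_def production_fms_def ord_prem_fms_def)
  qed
  then show ?thesis unfolding ord_prem_fms_def by (auto intro!: map_cong)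
qed

lemma ind_prem_fms_cong:
  fixes r :: "('f, 'q, 'p) production"
  assumes "\<And>x. x \<in> production_vars r \<Longrightarrow> \<sigma> x = \<tau> x"
  shows "ind_prem_fms \<sigma> r = ind_prem_fms \<tau> r"
proof -
  have "subst \<sigma> (Ind p ts :: ('f, 'q, 'p) fm) = subst \<tau> (Ind p ts)" if "(p, ts) \<in> set (ind_prems r)" for p ts
  proof (rule subst_cong)
    fix x assume "x \<in> fv (Ind p ts :: ('f, 'q, 'p) fm)"
    then show "\<sigma> x = \<tau> x"
      using that by (intro assms) (force simp: production_vars_def production_fms_def ind_prem_fms_def)
  qed
  then show ?thesis unfolding ind_prem_fms_def by (auto intro!: map_cong)
qed

lemma fv_head_args: "t \<in> set (head_args r) \<Longrightarrow> fv_trm t \<subseteq> production_vars r"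
  by (auto simp: production_vars_def production_fms_def head_fm_def)

section \<open>Pushing a substitution through a rule instance\<close>

text \<open>The choice depends on no sequent or rule, so one renaming serves all eigenvariables
  under \<open>\<theta>\<close> and all branches of a case distinction.\<close>

definition fresh_var :: "nat \<Rightarrow> 'f sub \<Rightarrow> nat \<Rightarrow> nat" where
  "fresh_var N \<theta> = (SOME g. inj_on g {..<N} \<and> g ` {..<N} \<subseteq> {..<2 * N} - (\<Union>x<N. fv_trm (\<theta> x)))"

text \<open>Counting: an atomic \<open>\<theta>\<close> contributes at most one variable for each of
  the \<open>N\<close> arguments, so at least \<open>N\<close> of the \<open>2 * N\<close> numbers
  remain free, enough for an injective image of \<open>{..<N}\<close>.\<close>

lemma fresh_var:
  assumes "atomic \<theta>"
  shows "inj_on (fresh_var N \<theta>) {..<N}"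
    and "fresh_var N \<theta> ` {..<N} \<subseteq> {..<2 * N} - (\<Union>x<N. fv_trm (\<theta> x))"
proof -
  have "card (fv_trm (\<theta> x)) \<le> 1" for x
    using assms[unfolded atomic_def, rule_format, of x] by auto
  then have "card (\<Union>x<N. fv_trm (\<theta> x)) \<le> N"
    using card_UN_le[of "{..<N}" "\<lambda>x. fv_trm (\<theta> x)"] sum_mono[of "{..<N}" "\<lambda>x. card (fv_trm (\<theta> x))" "\<lambda>_. 1"]
    by (auto intro: order_trans)
  then have "card {..<N} \<le> card ({..<2 * N} - (\<Union>x<N. fv_trm (\<theta> x)))"
    using diff_card_le_card_Diff[of "\<Union>x<N. fv_trm (\<theta> x)" "{..<2 * N}"] by simp
  then have "\<exists>g. inj_on g {..<N} \<and> g ` {..<N} \<subseteq> {..<2 * N} - (\<Union>x<N. fv_trm (\<theta> x))"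
    using card_le_inj[of "{..<N}" "{..<2 * N} - (\<Union>x<N. fv_trm (\<theta> x))"] by auto
  from someI_ex[OF this]
  show "inj_on (fresh_var N \<theta>) {..<N}"
    and "fresh_var N \<theta> ` {..<N} \<subseteq> {..<2 * N} - (\<Union>x<N. fv_trm (\<theta> x))"
    unfolding fresh_var_def by auto
qed

text \<open>Keeping \<open>\<theta>\<close> on the free variables of the conclusion leaves its
  instance unchanged. All other variables below \<open>N\<close> are renamed, among them the
  eigenvariables. From \<open>N\<close> on nothing changes, so that a pending substitution stays the
  identity there.\<close>

definition refresh :: "nat \<Rightarrow> ('f, 'q, 'p) sequent \<Rightarrow> 'f sub \<Rightarrow> 'f sub" where
  "refresh N S \<theta> = (\<lambda>x. if x \<in> fv_sequent S \<or> N \<le> x then \<theta> x else Var (fresh_var N \<theta> x))"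

lemma subst_refresh: "A \<in> fst S \<union> snd S \<Longrightarrow> subst (refresh N S \<theta>) A = subst \<theta> A"
  by (rule subst_cong) (auto simp: refresh_def fv_sequent_def)

text \<open>\<open>fresh_var\<close> avoids the values of \<open>\<theta>\<close> below
  \<open>N\<close> only, hence the bound on the free variables of \<open>S\<close>.\<close>

lemma fresh_var_notin:
  assumes "atomic \<theta>" "fv_sequent S \<subseteq> {..<N}" "x < N"
  shows "fresh_var N \<theta> x \<notin> fv_sequent (subst_sequent \<theta> S)"
  using fresh_var(2)[OF assms(1), of N] assms(2,3) by (auto simp: fv_subst_sequent)

text \<open>Source of the two marker variables for \<open>EqL\<close>. These may exceed
  \<open>2 * N\<close>: they occur in the new rule instance only and never enter a pending
  substitution, so finiteness is not affected.\<close>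

definition above :: "('f, 'q, 'p) sequent \<Rightarrow> 'f sub \<Rightarrow> nat" where
  "above S \<theta> = (SOME m. \<forall>x\<in>fv_sequent (subst_sequent \<theta> S). x < m)"

lemma above:
  assumes "finite (fv_sequent S)" "x \<in> fv_sequent S" "y \<in> fv_trm (\<theta> x)"
  shows "y < above S \<theta>"
proof -
  have "finite (fv_sequent (subst_sequent \<theta> S))"
    using assms(1) by (simp add: fv_subst_sequent)
  then have "\<exists>m. \<forall>x\<in>fv_sequent (subst_sequent \<theta> S). x < m"
    by (simp add: finite_nat_set_iff_bounded)
  from someI_ex[OF this] assms(2,3) show ?thesis
    unfolding above_def by (auto simp: fv_subst_sequent)
qed

definition eigenvars :: "('f, 'q, 'p) rule_inst \<Rightarrow> nat set" where
  "eigenvars R = (case R of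
     UniR \<Gamma> \<Delta> A x \<Rightarrow> {x}
   | ExiL \<Gamma> \<Delta> A x \<Rightarrow> {x}
   | UL \<Gamma> \<Delta> p us bs \<Rightarrow> (\<Union>(r, \<rho>)\<in>set bs. \<rho> ` production_vars r)
   | _ \<Rightarrow> {})"

text \<open>The pending substitution for every premise of \<open>R\<close>; it differs from
  \<open>\<theta>\<close> only at rules with eigenvariables.\<close>

definition premise_subst :: "nat \<Rightarrow> 'f sub \<Rightarrow> ('f, 'q, 'p) rule_inst \<Rightarrow> 'f sub" where
  "premise_subst N \<theta> R =
     (if rule_of R \<in> {R_UniR, R_ExiL, R_UL} then refresh N (concl R) \<theta> else \<theta>)"

declare eigenvars_def [simp] premise_subst_def [simp]

(* The two variables marking the replaced occurrences in EqL are exchanged for variables outside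
   the substituted context, as \<theta> may identify the old ones with others or map them to constants. *)

primrec push :: "nat \<Rightarrow> 'f sub \<Rightarrow> ('f, 'q, 'p) rule_inst \<Rightarrow> ('f, 'q, 'p) rule_inst" where
  "push N \<theta> (Axiom \<Gamma> \<Delta>) = Axiom (subst \<theta> ` \<Gamma>) (subst \<theta> ` \<Delta>)"
| "push N \<theta> (EqR \<Gamma> \<Delta> t) = EqR (subst \<theta> ` \<Gamma>) (subst \<theta> ` \<Delta>) (subst_trm \<theta> t)"
| "push N \<theta> (Wk \<Gamma> \<Delta> \<Gamma>' \<Delta>') =
     Wk (subst \<theta> ` \<Gamma>) (subst \<theta> ` \<Delta>) (subst \<theta> ` \<Gamma>') (subst \<theta> ` \<Delta>')"
| "push N \<theta> (Cut \<Gamma> \<Delta> A) = Cut (subst \<theta> ` \<Gamma>) (subst \<theta> ` \<Delta>) (subst \<theta> A)"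
| "push N \<theta> (Subst \<Gamma> \<Delta> \<sigma>) = Subst \<Gamma> \<Delta> \<sigma>"
| "push N \<theta> (NegL \<Gamma> \<Delta> A) = NegL (subst \<theta> ` \<Gamma>) (subst \<theta> ` \<Delta>) (subst \<theta> A)"
| "push N \<theta> (NegR \<Gamma> \<Delta> A) = NegR (subst \<theta> ` \<Gamma>) (subst \<theta> ` \<Delta>) (subst \<theta> A)"
| "push N \<theta> (DisjL \<Gamma> \<Delta> A B) = DisjL (subst \<theta> ` \<Gamma>) (subst \<theta> ` \<Delta>) (subst \<theta> A) (subst \<theta> B)"
| "push N \<theta> (DisjR \<Gamma> \<Delta> A B) = DisjR (subst \<theta> ` \<Gamma>) (subst \<theta> ` \<Delta>) (subst \<theta> A) (subst \<theta> B)"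
| "push N \<theta> (ConjL \<Gamma> \<Delta> A B) = ConjL (subst \<theta> ` \<Gamma>) (subst \<theta> ` \<Delta>) (subst \<theta> A) (subst \<theta> B)"
| "push N \<theta> (ConjR \<Gamma> \<Delta> A B) = ConjR (subst \<theta> ` \<Gamma>) (subst \<theta> ` \<Delta>) (subst \<theta> A) (subst \<theta> B)"
| "push N \<theta> (ImpL \<Gamma> \<Delta> A B) = ImpL (subst \<theta> ` \<Gamma>) (subst \<theta> ` \<Delta>) (subst \<theta> A) (subst \<theta> B)"
| "push N \<theta> (ImpR \<Gamma> \<Delta> A B) = ImpR (subst \<theta> ` \<Gamma>) (subst \<theta> ` \<Delta>) (subst \<theta> A) (subst \<theta> B)"
| "push N \<theta> (UniL \<Gamma> \<Delta> A t) =
     UniL (subst \<theta> ` \<Gamma>) (subst \<theta> ` \<Delta>) (subst (up \<theta>) A) (subst_trm \<theta> t)"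
| "push N \<theta> (UniR \<Gamma> \<Delta> A x) =
     UniR (subst \<theta> ` \<Gamma>) (subst \<theta> ` \<Delta>) (subst (up \<theta>) A) (fresh_var N \<theta> x)"
| "push N \<theta> (ExiL \<Gamma> \<Delta> A x) =
     ExiL (subst \<theta> ` \<Gamma>) (subst \<theta> ` \<Delta>) (subst (up \<theta>) A) (fresh_var N \<theta> x)"
| "push N \<theta> (ExiR \<Gamma> \<Delta> A t) =
     ExiR (subst \<theta> ` \<Gamma>) (subst \<theta> ` \<Delta>) (subst (up \<theta>) A) (subst_trm \<theta> t)"
| "push N \<theta> (EqL \<Gamma> \<Delta> t u x y) =
     (let m = above (\<Gamma>, \<Delta>) \<theta>; \<theta>' = \<theta>(x := Var m, y := Var (Suc m)) in
       EqL (subst \<theta>' ` \<Gamma>) (subst \<theta>' ` \<Delta>) (subst_trm \<theta> t) (subst_trm \<theta> u) m (Suc m))"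
| "push N \<theta> (UL \<Gamma> \<Delta> p us bs) =
     UL (subst \<theta> ` \<Gamma>) (subst \<theta> ` \<Delta>) p (map (subst_trm \<theta>) us)
       (map (\<lambda>(r, \<rho>). (r, \<lambda>x. fresh_var N \<theta> (\<rho> x))) bs)"
| "push N \<theta> (UR \<Gamma> \<Delta> r \<sigma>) =
     UR (subst \<theta> ` \<Gamma>) (subst \<theta> ` \<Delta>) r (\<lambda>x. subst_trm \<theta> (\<sigma> x))"

lemma rule_of_push [simp]: "rule_of (push N \<theta> R) = rule_of R"
  by (cases R) (simp_all add: Let_def)

text \<open>The replaced positions pass through the markers, and the values of
  \<open>\<theta>\<close> on the context contain no marker, so the outer substitution does not
  disturb them. Since \<open>t\<close> and \<open>u\<close> are arbitrary, the same context serves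
  the conclusion of \<open>EqL\<close> and, with the terms exchanged, its premise.\<close>

lemma subst_sub2_above:
  assumes "finite (fv_sequent S)" "F \<in> fst S \<union> snd S" "x \<noteq> y" "m = above S \<theta>"
  shows "subst (sub2 m (subst_trm \<theta> t) (Suc m) (subst_trm \<theta> u))
           (subst (\<theta>(x := Var m, y := Var (Suc m))) F) = subst \<theta> (subst (sub2 x t y u) F)"
  unfolding subst_subst
proof (rule subst_cong)
  fix z assume "z \<in> fv F"
  then have z: "z \<in> fv_sequent S" using assms(2) by (auto simp: fv_sequent_def)
  have "v \<noteq> m \<and> v \<noteq> Suc m" if "v \<in> fv_trm (\<theta> z)" for v
    using above[of S z v \<theta>, OF assms(1) z that] assms(4) by simp
  then have "subst_trm (sub2 m (subst_trm \<theta> t) (Suc m) (subst_trm \<theta> u)) (\<theta> z) = subst_trm Var (\<theta> z)"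
    by (intro subst_trm_cong) (auto simp: sub2_def)
  then show "subst_trm (sub2 m (subst_trm \<theta> t) (Suc m) (subst_trm \<theta> u))
               ((\<theta>(x := Var m, y := Var (Suc m))) z) = subst_trm \<theta> (sub2 x t y u z)"
    using assms(3) by (auto simp: sub2_def)
qed

lemma subst_refresh_renaming:
  assumes "fv_trm t \<subseteq> V" "\<rho> ` V \<subseteq> {..<N}" "\<rho> ` V \<inter> fv_sequent S = {}"
  shows "subst_trm (refresh N S \<theta>) (subst_trm (\<lambda>x. Var (\<rho> x)) t)
    = subst_trm (\<lambda>x. Var (fresh_var N \<theta> (\<rho> x))) t"
  unfolding subst_trm_subst_trm
proof (rule subst_trm_cong)
  fix x assume "x \<in> fv_trm t"
  then have "\<rho> x < N" "\<rho> x \<notin> fv_sequent S" using assms by auto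
  then show "subst_trm (refresh N S \<theta>) (Var (\<rho> x)) = Var (fresh_var N \<theta> (\<rho> x))"
    by (simp add: refresh_def)
qed

text \<open>Stated apart from \<open>case_fms\<close> because these atoms are exactly the ones to
  which a trace progresses.\<close>

lemma case_descendants_refresh:
  assumes "\<rho> ` production_vars r \<subseteq> {..<N}" "\<rho> ` production_vars r \<inter> fv_sequent S = {}"
  shows "subst (refresh N S \<theta>) ` case_descendants (r, \<rho>) =
    case_descendants (r, \<lambda>x. fresh_var N \<theta> (\<rho> x))"
proof -
  have "refresh N S \<theta> (\<rho> x) = Var (fresh_var N \<theta> (\<rho> x))" if "x \<in> production_vars r" for x
    using assms that by (auto simp: refresh_def)
  then have "ind_prem_fms (\<lambda>x. subst_trm (refresh N S \<theta>) (Var (\<rho> x))) r =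
      ind_prem_fms (\<lambda>x. Var (fresh_var N \<theta> (\<rho> x))) r"
    by (intro ind_prem_fms_cong) auto
  then have "map (subst (refresh N S \<theta>)) (ind_prem_fms (\<lambda>x. Var (\<rho> x)) r) =
      ind_prem_fms (\<lambda>x. Var (fresh_var N \<theta> (\<rho> x))) r"
    by (simp add: ind_prem_fms_subst)
  from arg_cong[where f = set, OF this] show ?thesis
    unfolding case_descendants_def by simp
qed

text \<open>The two sides of the equations behave differently: \<open>us\<close> comes from the
  conclusion, where refreshing has no effect, whereas the head arguments and premises of the
  production contain only eigenvariables, which are all renamed.\<close>

lemma case_fms_refresh:
  fixes r :: "('f, 'q, 'p) production"
  assumes "\<rho> ` production_vars r \<subseteq> {..<N}" "\<rho> ` production_vars r \<inter> fv_sequent S = {}"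
    and "Ind p us \<in> fst S \<union> snd S"
  shows "subst (refresh N S \<theta>) ` case_fms us (r, \<rho>) =
    case_fms (map (subst_trm \<theta>) us) (r, \<lambda>x. fresh_var N \<theta> (\<rho> x))"
proof -
  have "refresh N S \<theta> (\<rho> x) = Var (fresh_var N \<theta> (\<rho> x))" if "x \<in> production_vars r" for x
    using assms that by (auto simp: refresh_def)
  then have "ord_prem_fms (\<lambda>x. subst_trm (refresh N S \<theta>) (Var (\<rho> x))) r =
      ord_prem_fms (\<lambda>x. Var (fresh_var N \<theta> (\<rho> x))) r"
    by (intro ord_prem_fms_cong) auto
  then have ord: "map (subst (refresh N S \<theta>)) (ord_prem_fms (\<lambda>x. Var (\<rho> x)) r) =
      ord_prem_fms (\<lambda>x. Var (fresh_var N \<theta> (\<rho> x))) r"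
    by (simp add: ord_prem_fms_subst)
  have us: "map (subst_trm (refresh N S \<theta>)) us = map (subst_trm \<theta>) us"
    using subst_refresh[OF assms(3), of N \<theta>] by simp
  have args: "map (subst_trm (refresh N S \<theta>)) (map (subst_trm (\<lambda>x. Var (\<rho> x))) (head_args r)) =
      map (subst_trm (\<lambda>x. Var (fresh_var N \<theta> (\<rho> x)))) (head_args r)"
    unfolding map_map by (intro map_cong refl)
      (simp add: subst_refresh_renaming[OF fv_head_args assms(1,2)])
  have "map (subst (refresh N S \<theta>)) (map2 Eq us ts :: ('f, 'q, 'p) fm list) =
      map2 Eq (map (subst_trm (refresh N S \<theta>)) us) (map (subst_trm (refresh N S \<theta>)) ts)" for ts
    by (induction us ts rule: list_induct2') auto
  from this[unfolded us, of "map (subst_trm (\<lambda>x. Var (\<rho> x))) (head_args r)", unfolded args]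
  show ?thesis
    unfolding case_fms_def Let_def image_Un case_descendants_refresh[OF assms(1,2)]
    by (simp only: fst_conv snd_conv ord flip: set_map)
qed

lemma UL_renaming:
  assumes "valid_inst \<Sigma> \<Phi> (UL \<Gamma> \<Delta> p us bs)" "(r, \<rho>) \<in> set bs"
  shows "inj_on \<rho> (production_vars r)"
    and "\<rho> ` production_vars r \<inter> fv_sequent (concl (UL \<Gamma> \<Delta> p us bs)) = {}"
proof -
  have "\<forall>(r, \<rho>)\<in>set bs. inj_on \<rho> (production_vars r) \<and>
      \<rho> ` production_vars r \<inter> fv_sequent (concl (UL \<Gamma> \<Delta> p us bs)) = {}"
    using assms(1) unfolding valid_inst_def side_condition.simps by blast
  from bspec[OF this assms(2)]
  show "inj_on \<rho> (production_vars r)"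
    and "\<rho> ` production_vars r \<inter> fv_sequent (concl (UL \<Gamma> \<Delta> p us bs)) = {}"
    by simp_all
qed

text \<open>\<open>Subst\<close> is excluded because \<open>push\<close> returns it unchanged there
  as a placeholder; such nodes are skipped.\<close>

lemma concl_push:
  assumes "valid_inst \<Sigma> \<Phi> R" "rule_of R \<noteq> R_Subst"
  shows "concl (push N \<theta> R) = subst_sequent \<theta> (concl R)"
proof (cases R)
  case (EqL \<Gamma> \<Delta> t u x y)
  have *: "finite (fv_sequent (\<Gamma>, \<Delta>))" "x \<noteq> y"
    using assms EqL by (auto simp: valid_inst_def intro: finite_fv_sequent)
  show ?thesis
    unfolding EqL by (auto simp: subst_sequent_def Let_def image_image subst_sub2_above[OF *(1) _ *(2)])
qed (use assms in \<open>auto simp: subst_sequent_def head_fm_subst\<close>)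

text \<open>In rules with eigenvariables the refreshed substitution agrees with
  \<open>\<theta>\<close> on the context and the principal formula, and sends each eigenvariable to
  the name used by \<open>push\<close>. The latter needs the eigenvariables below
  \<open>N\<close>.\<close>

lemma prems_push:
  assumes R: "valid_inst \<Sigma> \<Phi> R" "rule_of R \<noteq> R_Subst" and N: "eigenvars R \<subseteq> {..<N}"
  shows "prems (push N \<theta> R) = map (subst_sequent (premise_subst N \<theta> R)) (prems R)"
proof (cases R)
  case (EqL \<Gamma> \<Delta> t u x y)
  have *: "finite (fv_sequent (\<Gamma>, \<Delta>))" "x \<noteq> y"
    using assms EqL by (auto simp: valid_inst_def intro: finite_fv_sequent)
  show ?thesis
    unfolding EqL by (auto simp: subst_sequent_def Let_def image_image subst_sub2_above[OF *(1) _ *(2)])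
next
  case (UniR \<Gamma> \<Delta> A x)
  have x: "x \<notin> fv_sequent (concl R)" "x < N" using assms UniR by (auto simp: valid_inst_def)
  let ?\<theta> = "refresh N (concl R) \<theta>"
  \<comment> \<open>\<open>Uni A\<close> itself belongs to the conclusion, so
    \<open>subst_refresh\<close> applies to it, and injectivity of \<open>Uni\<close> gives the
    equation for the body under \<open>up\<close>.\<close>
  have "subst (up ?\<theta>) A = subst (up \<theta>) A" "subst ?\<theta> ` \<Gamma> = subst \<theta> ` \<Gamma>" "subst ?\<theta> ` \<Delta> = subst \<theta> ` \<Delta>"
    using UniR subst_refresh[of "Uni A" "concl R" N \<theta>] by (auto intro!: image_cong subst_refresh)
  moreover have "subst_trm ?\<theta> (Var x) = Var (fresh_var N \<theta> x)"
    using x by (simp add: refresh_def)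
  ultimately show ?thesis unfolding UniR by (simp add: subst_sequent_def subst_inst)
next
  case (ExiL \<Gamma> \<Delta> A x)
  have x: "x \<notin> fv_sequent (concl R)" "x < N" using assms ExiL by (auto simp: valid_inst_def)
  let ?\<theta> = "refresh N (concl R) \<theta>"
  have "subst (up ?\<theta>) A = subst (up \<theta>) A" "subst ?\<theta> ` \<Gamma> = subst \<theta> ` \<Gamma>" "subst ?\<theta> ` \<Delta> = subst \<theta> ` \<Delta>"
    using ExiL subst_refresh[of "Exi A" "concl R" N \<theta>] by (auto intro!: image_cong subst_refresh)
  moreover have "subst_trm ?\<theta> (Var x) = Var (fresh_var N \<theta> x)"
    using x by (simp add: refresh_def)
  ultimately show ?thesis unfolding ExiL by (simp add: subst_sequent_def subst_inst)
next
  case (UL \<Gamma> \<Delta> p us bs)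
  let ?\<theta> = "refresh N (concl R) \<theta>"
  have \<Gamma>\<Delta>: "subst ?\<theta> ` \<Gamma> = subst \<theta> ` \<Gamma>" "subst ?\<theta> ` \<Delta> = subst \<theta> ` \<Delta>"
    using UL by (auto intro!: image_cong subst_refresh)
  have "subst ?\<theta> ` case_fms us (r, \<rho>) =
    case_fms (map (subst_trm \<theta>) us) (r, \<lambda>x. fresh_var N \<theta> (\<rho> x))" if "(r, \<rho>) \<in> set bs" for r \<rho>
    using N that UL_renaming(2)[OF R(1)[unfolded UL] that] unfolding UL
    by (intro case_fms_refresh[where p = p]) auto
  then have "(subst \<theta> ` \<Gamma> \<union> case_fms (map (subst_trm \<theta>) us) (case b of (r, \<rho>) \<Rightarrow> (r, \<lambda>x. fresh_var N \<theta> (\<rho> x))),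
        subst \<theta> ` \<Delta>) = subst_sequent ?\<theta> (\<Gamma> \<union> case_fms us b, \<Delta>)" if "b \<in> set bs" for b
    using that \<Gamma>\<Delta> by (cases b) (simp add: subst_sequent_def image_Un)
  then show ?thesis by (simp add: UL)
next
  case (UR \<Gamma> \<Delta> r \<sigma>)
  have "map (\<lambda>A. (subst \<theta> ` \<Gamma>, insert A (subst \<theta> ` \<Delta>))) (map (subst \<theta>) As) =
      map (subst_sequent \<theta>) (map (\<lambda>A. (\<Gamma>, insert A \<Delta>)) As)" for As
    by (simp add: subst_sequent_def)
  note this[of "ord_prem_fms \<sigma> r @ ind_prem_fms \<sigma> r"]
  moreover have "premise_subst N \<theta> (UR \<Gamma> \<Delta> r \<sigma>) = \<theta>" by simp
  ultimately show ?thesis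
    by (simp only: UR push.simps prems.simps map_append ord_prem_fms_subst ind_prem_fms_subst)
qed (use assms in \<open>auto simp: subst_sequent_def subst_inst\<close>)

lemma wf_refresh: "(\<And>x. wf_trm \<Sigma> (\<theta> x)) \<Longrightarrow> wf_trm \<Sigma> (refresh N S \<theta> x)"
  by (simp add: refresh_def)

lemma wf_premise_subst:
  "(\<And>x. wf_trm \<Sigma> (\<theta> x)) \<Longrightarrow> wf_trm \<Sigma> (premise_subst N \<theta> R x)"
  by (simp add: wf_refresh)

text \<open>The eigenvariable conditions hold because the fresh names miss the free variables of the
  substituted conclusion. For \<open>UL\<close>, injectivity of \<open>fresh_var\<close> below
  \<open>N\<close> keeps the composition with an injective \<open>\<rho>\<close> injective.\<close>

lemma valid_push:
  assumes R: "valid_inst \<Sigma> \<Phi> R" "rule_of R \<noteq> R_Subst"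
    and N: "eigenvars R \<subseteq> {..<N}" "fv_sequent (concl R) \<subseteq> {..<N}"
    and \<theta>: "atomic \<theta>" "\<And>x. wf_trm \<Sigma> (\<theta> x)"
  shows "valid_inst \<Sigma> \<Phi> (push N \<theta> R)"
proof -
  have concl: "concl (push N \<theta> R) = subst_sequent \<theta> (concl R)"
    using R by (rule concl_push)
  have "\<forall>S\<in>insert (concl (push N \<theta> R)) (set (prems (push N \<theta> R))). wf_sequent \<Sigma> S"
    using R(1) unfolding concl prems_push[OF R N(1)]
    by (auto simp: valid_inst_def intro!: wf_subst_sequent \<theta>(2) wf_premise_subst simp del: premise_subst_def)
  moreover have "side_condition \<Sigma> \<Phi> (push N \<theta> R)"
  proof (cases R)
    case (EqL \<Gamma> \<Delta> t u x y)
    then have "wf_sequent \<Sigma> (\<Gamma>, \<Delta>)" "wf_trm \<Sigma> t" "wf_trm \<Sigma> u" using R by (auto simp: valid_inst_def)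
    then show ?thesis
      using EqL wf_subst_sequent[of \<Sigma> "(\<Gamma>, \<Delta>)"] \<theta>(2)
      by (auto simp: Let_def subst_sequent_def intro!: wf_subst_trm)
  next
    case (UniR \<Gamma> \<Delta> A x)
    then show ?thesis
      using fresh_var_notin[OF \<theta>(1) N(2), of x] N(1) concl by auto
  next
    case (ExiL \<Gamma> \<Delta> A x)
    then show ?thesis
      using fresh_var_notin[OF \<theta>(1) N(2), of x] N(1) concl by auto
  next
    case (UL \<Gamma> \<Delta> p us bs)
    have fst: "map fst (map (\<lambda>(r, \<rho>). (r, \<lambda>x. fresh_var N \<theta> (\<rho> x))) bs) = map fst bs"
      by auto
    have "inj_on (\<lambda>x. fresh_var N \<theta> (\<rho> x)) (production_vars r)" 
      "(\<lambda>x. fresh_var N \<theta> (\<rho> x)) ` production_vars r \<inter> fv_sequent (concl (push N \<theta> R)) = {}"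
      if "(r, \<rho>) \<in> set bs" for r \<rho>
    proof -
      have \<rho>: "\<rho> ` production_vars r \<subseteq> {..<N}" "inj_on \<rho> (production_vars r)"
        using that N(1) UL UL_renaming(1)[OF R(1)[unfolded UL] that] by auto
      show "inj_on (\<lambda>x. fresh_var N \<theta> (\<rho> x)) (production_vars r)"
        using comp_inj_on[OF \<rho>(2) inj_on_subset[OF fresh_var(1)[OF \<theta>(1)] \<rho>(1)]]
        by (simp add: comp_def)
      show "(\<lambda>x. fresh_var N \<theta> (\<rho> x)) ` production_vars r \<inter> fv_sequent (concl (push N \<theta> R)) = {}"
        unfolding concl using fresh_var_notin[OF \<theta>(1) N(2)] \<rho>(1) by auto
    qed
    then have "\<forall>(r, \<rho>)\<in>set (map (\<lambda>(r, \<rho>). (r, \<lambda>x. fresh_var N \<theta> (\<rho> x))) bs).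
        inj_on \<rho> (production_vars r) \<and>
        \<rho> ` production_vars r \<inter> fv_sequent (concl (push N \<theta> R)) = {}"
      by (simp add: case_prod_beta)
    moreover have "distinct (map fst bs)" "set (map fst bs) = {r\<in>\<Phi>. head_pred r = p}"
      using R(1) unfolding UL valid_inst_def side_condition.simps by blast+
    ultimately show ?thesis
      unfolding UL push.simps side_condition.simps fst by blast
  next
    case (UR \<Gamma> \<Delta> r \<sigma>)
    then show ?thesis using R(1) \<theta>(2) by (auto simp: valid_inst_def intro!: wf_subst_trm)
  qed (use assms in \<open>auto simp: valid_inst_def intro!: wf_subst_trm\<close>)
  ultimately show ?thesis by (simp add: valid_inst_def)
qed

lemma progress_step_push:
  assumes R: "valid_inst \<Sigma> \<Phi> R" and N: "eigenvars R \<subseteq> {..<N}" and j: "j < length (prems R)"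
    and "progress_step R j C C'"
  shows "progress_step (push N \<theta> R) j (subst \<theta> C) (subst (premise_subst N \<theta> R) C')"
proof (cases R)
  case (UL \<Gamma> \<Delta> p us bs)
  obtain r \<rho> where b: "bs ! j = (r, \<rho>)" by (cases "bs ! j")
  have "(r, \<rho>) \<in> set bs" using b j UL by (auto simp: in_set_conv_nth)
  then have "subst (refresh N (concl R) \<theta>) ` case_descendants (r, \<rho>) =
      case_descendants (r, \<lambda>x. fresh_var N \<theta> (\<rho> x))"
    using UL_renaming(2)[OF R[unfolded UL], of r \<rho>] N unfolding UL
    by (intro case_descendants_refresh) auto
  then show ?thesis using UL b j assms(4) by auto
qed (use assms in auto)

text \<open>An atom copied from the conclusion receives the same instance under
  \<open>\<theta>\<close> and under the refreshed substitution, so a copy remains a copy. For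
  \<open>EqL\<close> the context formula witnessing the step is replaced by its image with
  markers.\<close>

lemma trace_step_push:
  assumes R: "valid_inst \<Sigma> \<Phi> R" "rule_of R \<noteq> R_Subst" and N: "eigenvars R \<subseteq> {..<N}"
    and j: "j < length (prems R)" and C: "C \<in> fst (concl R)" "trace_step R j C C'"
  shows "trace_step (push N \<theta> R) j (subst \<theta> C) (subst (premise_subst N \<theta> R) C')"
proof (cases R)
  case (EqL \<Gamma> \<Delta> t u x y)
  have *: "finite (fv_sequent (\<Gamma>, \<Delta>))" "x \<noteq> y"
    using assms EqL by (auto simp: valid_inst_def intro: finite_fv_sequent)
  obtain F where F: "F \<in> \<Gamma>" "C = subst (sub2 x t y u) F" "C' = subst (sub2 x u y t) F"
    using C EqL by auto
  then show ?thesis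
    using EqL by (auto simp: Let_def subst_sub2_above[OF *(1) _ *(2)] intro!: bexI[OF _ F(1)])
next
  case (UL \<Gamma> \<Delta> p us bs)
  have "subst (premise_subst N \<theta> R) C = subst \<theta> C"
    using UL C(1) by (simp add: subst_refresh del: concl.simps)
  then show ?thesis
    using UL C progress_step_push[OF R(1) N j, of C C' \<theta>] by auto
next
  case (UniR \<Gamma> \<Delta> A x)
  have "subst (premise_subst N \<theta> R) C = subst \<theta> C"
    using UniR C(1) by (simp add: subst_refresh del: concl.simps)
  then show ?thesis using UniR C(2) by simp
next
  case (ExiL \<Gamma> \<Delta> A x)
  have "subst (premise_subst N \<theta> R) C = subst \<theta> C"
    using ExiL C(1) by (simp add: subst_refresh del: concl.simps)
  then show ?thesis using ExiL C(2) by simp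
qed (use R(2) C in auto)

section \<open>Unravelling a finite graph of rule instances\<close>

text \<open>Paths extend an address at its end, while \<open>subtree\<close> recurses from its
  front.\<close>

lemma subtree_snoc:
  "subtree D (a @ [j]) = Some d \<longleftrightarrow>
    (\<exists>R ds. subtree D a = Some (Inf R ds) \<and> j < length ds \<and> d = ds ! j)"
proof (induction a arbitrary: D)
  case Nil
  show ?case by (cases D) auto
next
  case (Cons i a)
  then show ?case by (cases D) auto
qed

lemma rule_insts_subtree: "subtree D a = Some (Inf R ds) \<Longrightarrow> R \<in> rule_insts D"
proof (induction D a rule: subtree.induct)
  case (2 R' ds' j a)
  then have "j < length ds'" "R \<in> rule_insts (ds' ! j)" by (auto split: if_splits)
  then show ?case by force
qed auto

lemma subtree_rule_insts: "R \<in> rule_insts D \<Longrightarrow> \<exists>a ds. subtree D a = Some (Inf R ds)"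
proof (induction D)
  case (Inf R' ds')
  show ?case
  proof (cases "R = R'")
    case True
    then show ?thesis by (metis subtree.simps(1))
  next
    case False
    then obtain d where d: "d \<in> set ds'" "R \<in> rule_insts d" using Inf.prems by auto
    then obtain a ds where "subtree d a = Some (Inf R ds)" using Inf.IH by blast
    moreover obtain j where "j < length ds'" "d = ds' ! j" using d(1) by (metis in_set_conv_nth)
    ultimately have "subtree (Inf R' ds') (j # a) = Some (Inf R ds)" by simp
    then show ?thesis by blast
  qed
qed simp

lemma finite_addresses: "finite {a. subtree D a \<noteq> None}"
proof (induction D)
  case (Bud S c)
  have "{a. subtree (Bud S c) a \<noteq> None} \<subseteq> {[]}"
    by (auto elim: subtree.elims)
  then show ?case by (rule finite_subset) simp
next
  case (Inf R ds)
  have "a \<in> insert [] (\<Union>j<length ds. (#) j ` {a. subtree (ds ! j) a \<noteq> None})"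
    if "subtree (Inf R ds) a \<noteq> None" for a
    using that by (cases a) (auto split: if_splits)
  then have "{a. subtree (Inf R ds) a \<noteq> None} \<subseteq>
      insert [] (\<Union>j<length ds. (#) j ` {a. subtree (ds ! j) a \<noteq> None})" by blast
  moreover have "finite (\<Union>j<length ds. (#) j ` {a. subtree (ds ! j) a \<noteq> None})"
    using Inf.IH by auto
  ultimately show ?case by (meson finite_insert finite_subset)
qed

lemma finite_rule_insts: "finite (rule_insts D)"
  by (induction D) auto

text \<open>A finite presentation of a regular infinite derivation: a state carries a rule instance,
  and its successors conclude the premises in order.\<close>

locale inst_graph =
  fixes Q :: "'s set"
    and inst_of :: "'s \<Rightarrow> ('f, 'q, 'p) rule_inst"
    and succs :: "'s \<Rightarrow> 's list"
    and start :: 's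
  assumes finite_Q: "finite Q"
    and start: "start \<in> Q"
    and succs: "q \<in> Q \<Longrightarrow> set (succs q) \<subseteq> Q"
    and prems_inst_of: "q \<in> Q \<Longrightarrow> prems (inst_of q) = map (\<lambda>q. concl (inst_of q)) (succs q)"
begin

definition state :: "nat list \<Rightarrow> 's" where
  "state a = foldl (\<lambda>q j. succs q ! j) start a"

lemma state_simps [simp]: "state [] = start" "state (a @ [j]) = succs (state a) ! j"
  by (simp_all add: state_def)

text \<open>A branch is cut as soon as its state has occurred on the way from the root, so
  companions are always ancestors. The first argument is fuel for the recursion; the value at 0 is a
  dummy.\<close>

primrec unravel :: "nat \<Rightarrow> nat list \<Rightarrow> ('f, 'q, 'p) deriv_tree" where
  "unravel 0 a = Bud ({}, {}) []"
| "unravel (Suc n) a =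
     (if \<exists>k<length a. state (take k a) = state a
      then Bud (concl (inst_of (state a))) (take (LEAST k. state (take k a) = state a) a)
      else Inf (inst_of (state a)) (map (\<lambda>j. unravel n (a @ [j])) [0..<length (succs (state a))]))"

(* A branch without repeated states has at most card Q nodes, so the bound is never exhausted. *)

definition tree :: "('f, 'q, 'p) deriv_tree" where
  "tree = unravel (Suc (card Q)) []"

lemma root_sequent_unravel: "root_sequent (unravel (Suc n) a) = concl (inst_of (state a))"
  by simp

text \<open>No proper prefix of an address in the tree was cut, so the states along it are distinct
  and their number is at most \<open>card Q\<close>. Hence the remaining fuel is a successor and the
  dummy is never reached. The last conjunct makes every proper prefix eligible as a
  companion.\<close>

lemma subtree_tree:
  assumes "subtree tree a = Some d"
  shows "length a \<le> card Q \<and> d = unravel (Suc (card Q - length a)) a \<and>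
    inj_on (\<lambda>k. state (take k a)) {..<length a} \<and> (\<forall>k\<le>length a. state (take k a) \<in> Q) \<and>
    (\<forall>k<length a. \<exists>R ds. subtree tree (take k a) = Some (Inf R ds) \<and> ds \<noteq> [])"
  using assms
proof (induction a arbitrary: d rule: rev_induct)
  case Nil
  then show ?case by (simp add: tree_def start)
next
  case (snoc j a)
  then obtain R ds where D: "subtree tree a = Some (Inf R ds)" "j < length ds" "d = ds ! j"
    by (auto simp: subtree_snoc)
  note IH = snoc.IH[OF D(1)]
  let ?s = "\<lambda>k. state (take k (a @ [j]))"
  \<comment> \<open>The node at \<open>a\<close> has a child, so it is not a bud and its state is
    new on the branch.\<close>
  have new: "\<not> (\<exists>k<length a. state (take k a) = state a)"
    and ds: "ds = map (\<lambda>j. unravel (card Q - length a) (a @ [j])) [0..<length (succs (state a))]"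
    using IH by (auto split: if_splits)
  have "inj_on (\<lambda>k. state (take k a)) (insert (length a) {..<length a})"
    using IH new by (subst inj_on_insert) force
  then have inj: "inj_on ?s {..<length (a @ [j])}"
    by (auto simp: inj_on_def less_Suc_eq)
  have "j < length (succs (state a))" using D(2) ds by simp
  moreover have "state a \<in> Q" using IH by (metis order_refl take_all)
  ultimately have "state (a @ [j]) \<in> Q" using succs[of "state a"] by (auto simp: subset_iff)
  then have Q: "\<forall>k\<le>length (a @ [j]). ?s k \<in> Q"
    using IH by (auto simp: le_Suc_eq simp del: state_simps)
  then have "?s ` {..<length (a @ [j])} \<subseteq> Q"
    by (blast intro: less_imp_le)
  then have "card (?s ` {..<length (a @ [j])}) \<le> card Q"
    by (intro card_mono finite_Q)
  then have len: "length (a @ [j]) \<le> card Q"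
    using card_image[OF inj] by simp
  have "d = unravel (Suc (card Q - length (a @ [j]))) (a @ [j])"
    using D(2,3) ds len by (simp add: Suc_diff_Suc del: unravel.simps)
  moreover have "\<exists>R ds. subtree tree (take k (a @ [j])) = Some (Inf R ds) \<and> ds \<noteq> []"
    if "k < length (a @ [j])" for k
  proof (cases "k = length a")
    case True
    then have "take k (a @ [j]) = a" by simp
    moreover have "ds \<noteq> []" using D(2) by auto
    ultimately show ?thesis using D(1) by metis
  qed (use that IH in auto)
  ultimately show ?case using inj Q len by blast
qed

lemma state_in_Q: "subtree tree a = Some d \<Longrightarrow> state a \<in> Q"
  using subtree_tree[of a d] by (metis order_refl take_all)

lemma root_sequent_subtree: "subtree tree a = Some d \<Longrightarrow> root_sequent d = concl (inst_of (state a))"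
  using subtree_tree[of a d] root_sequent_unravel by blast

lemma subtree_tree_Inf:
  assumes "subtree tree a = Some (Inf R ds)"
  shows "R = inst_of (state a)" "length ds = length (succs (state a))" "map root_sequent ds = prems R"
proof -
  show R: "R = inst_of (state a)" and len: "length ds = length (succs (state a))"
    using subtree_tree[OF assms] by (auto split: if_splits)
  have "root_sequent (ds ! j) = concl (inst_of (succs (state a) ! j))" if "j < length ds" for j
    using root_sequent_subtree[of "a @ [j]" "ds ! j"] assms that by (simp add: subtree_snoc)
  then show "map root_sequent ds = prems R"
    unfolding R prems_inst_of[OF state_in_Q[OF assms]] using len by (auto intro!: nth_equalityI)
qed

lemma subtree_tree_Bud:
  assumes "subtree tree a = Some (Bud S c)"
  shows "state c = state a" "\<exists>R ds. subtree tree c = Some (Inf R ds) \<and> ds \<noteq> [] \<and> concl R = S"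
proof -
  define k where "k = (LEAST k. state (take k a) = state a)"
  have ex: "\<exists>k<length a. state (take k a) = state a" and S: "S = concl (inst_of (state a))"
    and c: "c = take k a"
    using subtree_tree[OF assms] by (auto simp: k_def split: if_splits)
  obtain k' where k': "k' < length a" "state (take k' a) = state a" using ex by blast
  \<comment> \<open>\<open>length a\<close> also solves the equation, so the comparison with
    \<open>k'\<close> is what makes the least solution a proper prefix.\<close>
  have k: "state (take k a) = state a" "k < length a"
    using LeastI[of "\<lambda>k. state (take k a) = state a", OF k'(2)]
      Least_le[of "\<lambda>k. state (take k a) = state a", OF k'(2)] k'(1) unfolding k_def by auto
  show "state c = state a" using k c by simp
  obtain R ds where Rds: "subtree tree c = Some (Inf R ds)" "ds \<noteq> []"
    using subtree_tree[OF assms] k(2) c by blast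
  then show "\<exists>R ds. subtree tree c = Some (Inf R ds) \<and> ds \<noteq> [] \<and> concl R = S"
    using subtree_tree_Inf(1)[OF Rds(1)] S \<open>state c = state a\<close> by auto
qed

lemma pre_proof_tree:
  assumes "\<And>q. q \<in> Q \<Longrightarrow> valid_inst \<Sigma> \<Phi> (inst_of q)"
  shows "pre_proof \<Sigma> \<Phi> tree"
  unfolding pre_proof_def
proof (intro conjI allI impI)
  fix a R ds assume a: "subtree tree a = Some (Inf R ds)"
  show "valid_inst \<Sigma> \<Phi> R" using assms[OF state_in_Q[OF a]] subtree_tree_Inf(1)[OF a] by simp
  show "map root_sequent ds = prems R" using subtree_tree_Inf(3)[OF a] .
qed (rule subtree_tree_Bud(2))

lemma rules_used_tree: "rules_used tree \<subseteq> (\<lambda>q. rule_of (inst_of q)) ` Q"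
proof
  fix \<rho> assume "\<rho> \<in> rules_used tree"
  then obtain R where R: "R \<in> rule_insts tree" "\<rho> = rule_of R" by (auto simp: rules_used_def)
  then obtain a ds where a: "subtree tree a = Some (Inf R ds)" using subtree_rule_insts by blast
  show "\<rho> \<in> (\<lambda>q. rule_of (inst_of q)) ` Q"
    using R(2) subtree_tree_Inf(1)[OF a] state_in_Q[OF a] by blast
qed

lemma root_sequent_tree: "root_sequent tree = concl (inst_of start)"
  using root_sequent_subtree[of "[]"] by simp

end

(* Empty blocks occur where a path goes from a bud to its companion. *)

lemma concat_blocks:
  fixes blk :: "nat \<Rightarrow> nat \<Rightarrow> 's" and len :: "nat \<Rightarrow> nat"
  assumes ends: "\<And>i. blk i (len i) = blk (Suc i) 0" and nonempty: "\<And>i. len i > 0 \<or> len (Suc i) > 0"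
  shows "\<exists>p h. h 0 = 0 \<and> (\<forall>i. h (Suc i) = h i + len i) \<and>
    (\<forall>i l. l \<le> len i \<longrightarrow> p (h i + l) = blk i l) \<and> (\<forall>m. \<exists>i. h i \<le> m \<and> m < h (Suc i))"
proof -
  define h where "h i = sum len {..<i}" for i
  define ix where "ix m = (LEAST i. m < h (Suc i))" for m
  define p where "p m = blk (ix m) (m - h (ix m))" for m
  have h: "h 0 = 0" "h (Suc i) = h i + len i" for i by (simp_all add: h_def)
  have mono: "h i \<le> h j" if "i \<le> j" for i j
    using that by (induction j rule: dec_induct) (auto simp: h)
  \<comment> \<open>Of two consecutive blocks at least one is nonempty, so two blocks add at least 1
    and every position is eventually covered.\<close>
  have grow: "i \<le> h (2 * i)" for i
  proof (induction i)
    case (Suc i)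
    then show ?case using nonempty[of "2 * i"] h(2)[of "2 * i"] h(2)[of "Suc (2 * i)"] by auto
  qed simp
  have ix: "h (ix m) \<le> m" "m < h (Suc (ix m))" for m
  proof -
    have "m < h (Suc (2 * m + 1))" using grow[of "m + 1"] by simp
    then show "m < h (Suc (ix m))" unfolding ix_def by (rule LeastI)
    show "h (ix m) \<le> m"
    proof (cases "ix m")
      case (Suc i)
      then have "\<not> m < h (Suc i)" unfolding ix_def by (intro not_less_Least) simp
      then show ?thesis using Suc by simp
    qed (simp add: h)
  qed
  have ix_eq: "ix m = i" if "h i \<le> m" "m < h (Suc i)" for i m
  proof (rule antisym)
    show "ix m \<le> i" unfolding ix_def using that(2) by (rule Least_le)
    show "i \<le> ix m" using mono[of "Suc (ix m)" i] ix(2)[of m] that(1) by (cases "i \<le> ix m") auto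
  qed
  have lt: "p (h i + l) = blk i l" if "l < len i" for i l
    using ix_eq[of i "h i + l"] that by (simp add: p_def h)
  \<comment> \<open>If block \<open>Suc i\<close> is empty, the following one is nonempty and starts
    at the same position, with the same value by \<open>ends\<close>.\<close>
  have "p (h (Suc i)) = blk (Suc i) 0" for i
  proof (cases "len (Suc i) > 0")
    case False
    then have "p (h (Suc (Suc i))) = blk (Suc (Suc i)) 0" using lt[of 0 "Suc (Suc i)"] nonempty[of "Suc i"] by simp
    then show ?thesis using False ends[of "Suc i"] h(2)[of "Suc i"] by simp
  qed (use lt[of 0 "Suc i"] in simp)
  then have "p (h i + len i) = blk i (len i)" for i using ends h by simp
  then have "p (h i + l) = blk i l" if "l \<le> len i" for i l
    using lt that by (cases "l = len i") auto
  with h ix show ?thesis by (intro exI[of _ p] exI[of _ h]) blast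
qed

section \<open>Eliminating Subst\<close>

definition subst_vars :: "'f sub \<Rightarrow> nat set" where
  "subst_vars \<sigma> = (\<Union>x\<in>{x. \<sigma> x \<noteq> Var x}. insert x (fv_trm (\<sigma> x)))"

text \<open>What has to lie below \<open>N\<close>: free variables, so that fresh names avoid their
  images; eigenvariables, so that they get renamed; and the variables of \<open>\<sigma>\<close>, so
  that composition stays within the range of pending substitutions.\<close>

definition inst_vars :: "('f, 'q, 'p) rule_inst \<Rightarrow> nat set" where
  "inst_vars R = fv_sequent (concl R) \<union> eigenvars R \<union>
     (case R of Subst \<Gamma> \<Delta> \<sigma> \<Rightarrow> subst_vars \<sigma> | _ \<Rightarrow> {})"

lemma finite_production_vars: "finite (production_vars r)"
  by (simp add: production_vars_def production_fms_def)

lemma finite_inst_vars: "valid_inst \<Sigma> \<Phi> R \<Longrightarrow> finite (inst_vars R)"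
  using finite_fv_sequent[of \<Sigma> "concl R"]
  by (cases R) (auto simp: inst_vars_def valid_inst_def subst_vars_def substitution_def
      finite_production_vars simp del: concl.simps)

locale atomic_proof =
  fixes \<Sigma> :: "('f, 'q, 'p) signature" and \<Phi> :: "('f, 'q, 'p) production set"
    and Pr :: "('f, 'q, 'p) deriv_tree" and N :: nat
  assumes pre_proof: "pre_proof \<Sigma> \<Phi> Pr"
    and global_trace: "global_trace_condition Pr"
    and atomic: "Subst \<Gamma> \<Delta> \<sigma> \<in> rule_insts Pr \<Longrightarrow> atomic \<sigma>"
    and inst_vars: "R \<in> rule_insts Pr \<Longrightarrow> inst_vars R \<subseteq> {..<N}"
begin

lemma subtree_Inf:
  assumes "subtree Pr a = Some (Inf R ds)"
  shows "valid_inst \<Sigma> \<Phi> R" "map root_sequent ds = prems R" "eigenvars R \<subseteq> {..<N}"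
    "fv_sequent (concl R) \<subseteq> {..<N}" "R \<in> rule_insts Pr"
proof -
  show "valid_inst \<Sigma> \<Phi> R" "map root_sequent ds = prems R"
    using pre_proof assms by (auto simp: pre_proof_def)
  show "R \<in> rule_insts Pr" using rule_insts_subtree[OF assms] .
  from inst_vars[OF this] show "eigenvars R \<subseteq> {..<N}" "fv_sequent (concl R) \<subseteq> {..<N}"
    by (simp_all add: inst_vars_def del: eigenvars_def)
qed

lemma subtree_Bud:
  assumes "subtree Pr a = Some (Bud S c)"
  obtains R ds where "subtree Pr c = Some (Inf R ds)" "concl R = S"
  using pre_proof assms unfolding pre_proof_def by blast

section \<open>The finite set of pending substitutions\<close>

definition constants :: "'f trm set" where
  "constants = {t. \<exists>\<Gamma> \<Delta> \<sigma> x. Subst \<Gamma> \<Delta> \<sigma> \<in> rule_insts Pr \<and> \<sigma> x = t \<and> (\<exists>c. t = Fn c [])}"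

text \<open>Contains the identity and is closed under both operations on pending substitutions,
  composition at \<open>Subst\<close> and refreshing at eigenvariables.\<close>

definition subs :: "'f sub set" where
  "subs = {\<theta>. (\<forall>x<N. \<theta> x \<in> Var ` {..<2 * N} \<union> constants) \<and> (\<forall>x\<ge>N. \<theta> x = Var x)}"

lemma subsI:
  assumes "\<And>x. if x < N then \<theta> x \<in> Var ` {..<2 * N} \<union> constants else \<theta> x = Var x"
  shows "\<theta> \<in> subs"
proof -
  have "\<theta> x \<in> Var ` {..<2 * N} \<union> constants" if "x < N" for x
    using assms[of x] that by simp
  moreover have "\<theta> x = Var x" if "N \<le> x" for x
    using assms[of x] that by simp
  ultimately show ?thesis by (simp add: subs_def)
qed

lemma subsD: "\<theta> \<in> subs \<Longrightarrow> if x < N then \<theta> x \<in> Var ` {..<2 * N} \<union> constants else \<theta> x = Var x"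
  unfolding subs_def by (simp add: not_less del: Un_iff)

lemma Subst_inst:
  assumes "Subst \<Gamma> \<Delta> \<sigma> \<in> rule_insts Pr"
  shows "substitution \<Sigma> \<sigma>" "subst_vars \<sigma> \<subseteq> {..<N}"
proof -
  obtain a ds where "subtree Pr a = Some (Inf (Subst \<Gamma> \<Delta> \<sigma>) ds)"
    using subtree_rule_insts[OF assms] by blast
  from subtree_Inf(1)[OF this] show "substitution \<Sigma> \<sigma>" by (simp add: valid_inst_def)
  show "subst_vars \<sigma> \<subseteq> {..<N}" using inst_vars[OF assms] by (simp add: inst_vars_def)
qed

lemma finite_constants: "finite constants"
proof (rule finite_subset)
  let ?f = "\<lambda>R. case R of Subst \<Gamma> \<Delta> \<sigma> \<Rightarrow> \<sigma> ` {x. \<sigma> x \<noteq> Var x} | _ \<Rightarrow> {}"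
  show "constants \<subseteq> (\<Union>R\<in>rule_insts Pr. ?f R)"
  proof
    fix t assume "t \<in> constants"
    then obtain \<Gamma> \<Delta> \<sigma> x c where t: "Subst \<Gamma> \<Delta> \<sigma> \<in> rule_insts Pr" "\<sigma> x = t" "t = Fn c []"
      by (auto simp: constants_def)
    \<comment> \<open>A constant is thus the image of one of the finitely many variables moved by
      \<open>\<sigma>\<close>.\<close>
    then have "\<sigma> x \<noteq> Var x" by simp
    with t(2) have "t \<in> \<sigma> ` {x. \<sigma> x \<noteq> Var x}" by blast
    then have "t \<in> ?f (Subst \<Gamma> \<Delta> \<sigma>)" by simp
    then show "t \<in> (\<Union>R\<in>rule_insts Pr. ?f R)" using t(1) by blast
  qed
  have "finite (?f R)" if "R \<in> rule_insts Pr" for R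
    using that Subst_inst(1) by (cases R) (auto simp: substitution_def)
  then show "finite (\<Union>R\<in>rule_insts Pr. ?f R)" using finite_rule_insts by blast
qed

lemma finite_subs: "finite subs"
proof (rule finite_subset)
  let ?B = "Var ` {..<2 * N} \<union> constants"
  \<comment> \<open>The finiteness theorem for functions wants a constant default outside the
    domain, but members of \<open>subs\<close> are the identity there. \<open>Var 0\<close> is an
    arbitrary default, overwritten by the map applied to \<open>?F\<close>.\<close>
  let ?F = "{f. \<forall>x. (x \<in> {..<N} \<longrightarrow> f x \<in> ?B) \<and> (x \<notin> {..<N} \<longrightarrow> f x = Var 0)}"
  show "subs \<subseteq> (\<lambda>f x. if x < N then f x else Var x) ` ?F"
  proof
    fix \<theta> assume "\<theta> \<in> subs"
    then have *: "if x < N then \<theta> x \<in> ?B else \<theta> x = Var x" for x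
      by (rule subsD)
    have "\<theta> = (\<lambda>x. if x < N then (if x < N then \<theta> x else Var 0) else Var x)"
    proof
      fix x show "\<theta> x = (if x < N then (if x < N then \<theta> x else Var 0) else Var x)"
        using *[of x] by auto
    qed
    moreover have "\<theta> x \<in> ?B" if "x < N" for x using *[of x] that by simp
    then have "(\<lambda>x. if x < N then \<theta> x else Var 0) \<in> ?F" by simp
    ultimately show "\<theta> \<in> (\<lambda>f x. if x < N then f x else Var x) ` ?F"
      by (rule image_eqI)
  qed
  have "finite ?F" by (rule finite_set_of_finite_funs) (auto intro: finite_constants)
  then show "finite ((\<lambda>f x. if x < N then f x else Var x) ` ?F)" by simp
qed

lemma subs_atomic:
  assumes "\<theta> \<in> subs"
  shows "atomic \<theta>"
  unfolding atomic_def
proof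
  fix x
  have "if x < N then \<theta> x \<in> Var ` {..<2 * N} \<union> constants else \<theta> x = Var x"
    using subsD[OF assms] .
  then show "(\<exists>y. \<theta> x = Var y) \<or> (\<exists>c. \<theta> x = Fn c [])"
    by (auto simp: constants_def split: if_splits)
qed

lemma subs_wf:
  assumes "\<theta> \<in> subs"
  shows "wf_trm \<Sigma> (\<theta> x)"
proof -
  have "if x < N then \<theta> x \<in> Var ` {..<2 * N} \<union> constants else \<theta> x = Var x"
    using subsD[OF assms] .
  moreover have "wf_trm \<Sigma> t" if "t \<in> constants" for t
    using that Subst_inst(1) by (auto simp: constants_def substitution_def)
  ultimately show ?thesis by (auto split: if_splits)
qed

lemma Var_in_subs: "Var \<in> subs"
  by (simp add: subs_def)

text \<open>A variable moved by \<open>\<sigma>\<close> goes to a constant, which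
  \<open>\<theta>\<close> leaves alone, or to a variable still below \<open>N\<close>, where
  \<open>\<theta>\<close> has an admissible value.\<close>

lemma comp_in_subs:
  assumes "\<theta> \<in> subs" "Subst \<Gamma> \<Delta> \<sigma> \<in> rule_insts Pr"
  shows "(\<lambda>x. subst_trm \<theta> (\<sigma> x)) \<in> subs"
proof -
  have \<theta>: "if x < N then \<theta> x \<in> Var ` {..<2 * N} \<union> constants else \<theta> x = Var x" for x
    using subsD[OF assms(1)] .
  have "if x < N then subst_trm \<theta> (\<sigma> x) \<in> Var ` {..<2 * N} \<union> constants
      else subst_trm \<theta> (\<sigma> x) = Var x" for x
  proof (cases "\<sigma> x = Var x")
    case True
    then show ?thesis using \<theta>[of x] by (simp split: if_splits)
  next
    case False
    then have x: "x < N" "fv_trm (\<sigma> x) \<subseteq> {..<N}"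
      using Subst_inst(2)[OF assms(2)] by (auto simp: subst_vars_def)
    consider y where "\<sigma> x = Var y" | c where "\<sigma> x = Fn c []"
      using atomic[OF assms(2)] unfolding atomic_def by blast
    then show ?thesis
    proof cases
      case 1
      then show ?thesis using x \<theta>[of y] by (simp split: if_splits)
    next
      case 2
      then have "\<sigma> x \<in> constants" using assms(2) by (auto simp: constants_def)
      then show ?thesis using x(1) 2 by simp
    qed
  qed
  then show ?thesis by (rule subsI)
qed

lemma refresh_in_subs:
  assumes "\<theta> \<in> subs"
  shows "refresh N S \<theta> \<in> subs"
proof (rule subsI)
  fix x
  show "if x < N then refresh N S \<theta> x \<in> Var ` {..<2 * N} \<union> constants else refresh N S \<theta> x = Var x"
    using subsD[OF assms, of x] fresh_var(2)[OF subs_atomic[OF assms], of N]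
    by (auto simp: refresh_def)
qed

lemma premise_subst_in_subs: "\<theta> \<in> subs \<Longrightarrow> premise_subst N \<theta> R \<in> subs"
  by (simp add: refresh_in_subs)

(* A pair of an address and a substitution stands for the sequent at the address under the
   substitution. *)

definition pairs :: "(nat list \<times> 'f sub) set" where
  "pairs = {a. subtree Pr a \<noteq> None} \<times> subs"

definition pair_sequent :: "nat list \<times> 'f sub \<Rightarrow> ('f, 'q, 'p) sequent" where
  "pair_sequent q = subst_sequent (snd q) (root_sequent (the (subtree Pr (fst q))))"

section \<open>Skipping buds and instances of \<open>Subst\<close>\<close>

definition silent :: "nat list \<Rightarrow> bool" where
  "silent a \<longleftrightarrow> (case the (subtree Pr a) of Bud S c \<Rightarrow> True | Inf R ds \<Rightarrow> rule_of R = R_Subst)"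

text \<open>At \<open>Subst\<close> the \<open>\<theta>\<close>-instance of the conclusion is the
  instance of the premise under \<open>\<sigma>\<close> followed by \<open>\<theta>\<close>, so the
  node is dropped by composing. The last branch is a dummy for other rules.\<close>

fun silent_next :: "nat list \<times> 'f sub \<Rightarrow> nat list \<times> 'f sub" where
  "silent_next (a, \<theta>) =
     (case the (subtree Pr a) of
        Bud S c \<Rightarrow> (c, \<theta>)
      | Inf R ds \<Rightarrow>
          (case R of Subst \<Gamma> \<Delta> \<sigma> \<Rightarrow> (a @ [0], \<lambda>x. subst_trm \<theta> (\<sigma> x)) | _ \<Rightarrow> (a, \<theta>)))"

lemma silent_cases:
  assumes "(a, \<theta>) \<in> pairs" "silent a"
  obtains (Bud) S c where "subtree Pr a = Some (Bud S c)" "silent_next (a, \<theta>) = (c, \<theta>)"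
  | (Subst) \<Gamma> \<Delta> \<sigma> d where "subtree Pr a = Some (Inf (Subst \<Gamma> \<Delta> \<sigma>) [d])"
      "silent_next (a, \<theta>) = (a @ [0], \<lambda>x. subst_trm \<theta> (\<sigma> x))" "root_sequent d = (\<Gamma>, \<Delta>)"
proof -
  from assms(1) obtain D where D: "subtree Pr a = Some D" by (auto simp: pairs_def)
  show thesis
  proof (cases D)
    case (Bud S c)
    then show thesis using D that(1) by simp
  next
    case (Inf R ds)
    then have "rule_of R = R_Subst" using assms(2) D by (simp add: silent_def)
    then obtain \<Gamma> \<Delta> \<sigma> where R: "R = Subst \<Gamma> \<Delta> \<sigma>" by (cases R) auto
    have "map root_sequent ds = [(\<Gamma>, \<Delta>)]"
      using subtree_Inf(2)[of a R ds] D Inf R by simp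
    then obtain d where "ds = [d]" "root_sequent d = (\<Gamma>, \<Delta>)" by auto
    then show thesis using D Inf R that(2) by simp
  qed
qed

lemma silent_next:
  assumes "q \<in> pairs" "silent (fst q)"
  shows "silent_next q \<in> pairs" "pair_sequent (silent_next q) = pair_sequent q"
    "edge Pr (fst q) (fst (silent_next q))"
proof -
  obtain a \<theta> where q: "q = (a, \<theta>)" by (cases q)
  have "(a, \<theta>) \<in> pairs" "silent a" using assms q by auto
  then have "silent_next q \<in> pairs \<and> pair_sequent (silent_next q) = pair_sequent q \<and>
      edge Pr (fst q) (fst (silent_next q))"
  proof (cases rule: silent_cases)
    case (Bud S c)
    obtain R ds where "subtree Pr c = Some (Inf R ds)" "concl R = S"
      using subtree_Bud[OF Bud(1)] .
    then show ?thesis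
      using Bud \<open>(a, \<theta>) \<in> pairs\<close> q by (simp add: pairs_def pair_sequent_def edge_def)
  next
    case (Subst \<Gamma> \<Delta> \<sigma> d)
    have "subtree Pr (a @ [0]) = Some d" using Subst(1) by (simp add: subtree_snoc)
    moreover have "(\<lambda>x. subst_trm \<theta> (\<sigma> x)) \<in> subs"
      using comp_in_subs subtree_Inf(5)[OF Subst(1)] \<open>(a, \<theta>) \<in> pairs\<close> by (auto simp: pairs_def)
    moreover have "subst_sequent \<theta> (concl (Subst \<Gamma> \<Delta> \<sigma>)) =
        subst_sequent (\<lambda>x. subst_trm \<theta> (\<sigma> x)) (\<Gamma>, \<Delta>)"
      by (simp add: subst_sequent_def image_image subst_subst)
    ultimately show ?thesis
      using Subst q by (simp add: pairs_def pair_sequent_def edge_def del: concl.simps)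
  qed
  then show "silent_next q \<in> pairs" "pair_sequent (silent_next q) = pair_sequent q"
    "edge Pr (fst q) (fst (silent_next q))" by blast+
qed

(* A path along buds and instances of Subst only would have no progressing point. *)

lemma silent_terminates:
  assumes "q \<in> pairs"
  shows "\<exists>n. \<not> silent (fst ((silent_next ^^ n) q))"
proof (rule ccontr)
  assume "\<not> ?thesis"
  then have silent: "silent (fst ((silent_next ^^ n) q))" for n by blast
  define e where "e n = fst ((silent_next ^^ n) q)" for n
  have pairs: "(silent_next ^^ n) q \<in> pairs" for n
    by (induction n) (use assms silent_next(1) silent in auto)
  then have "infinite_path Pr e"
    unfolding infinite_path_def e_def using silent_next(3) silent by simp
  then obtain k C where inf: "infinite {i. progressing_point Pr (\<lambda>i. e (k + i)) C i}"
    using global_trace unfolding global_trace_condition_def by blast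
  have "\<not> progressing_point Pr (\<lambda>i. e (k + i)) C i" for i
  proof
    assume "progressing_point Pr (\<lambda>i. e (k + i)) C i"
    then obtain R ds j C1 C2 where R: "subtree Pr (e (k + i)) = Some (Inf R ds)" "progress_step R j C1 C2"
      unfolding progressing_point_def by blast
    then have "rule_of R = R_Subst" using silent[of "k + i"] by (simp add: silent_def e_def)
    then show False using R(2) by (cases R) auto
  qed
  then show False using inf by simp
qed

definition skip :: "nat list \<times> 'f sub \<Rightarrow> nat" where
  "skip q = (LEAST n. \<not> silent (fst ((silent_next ^^ n) q)))"

definition reach :: "nat list \<times> 'f sub \<Rightarrow> nat list \<times> 'f sub" where
  "reach q = (silent_next ^^ skip q) q"

lemma silent_before_skip: "n < skip q \<Longrightarrow> silent (fst ((silent_next ^^ n) q))"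
  unfolding skip_def using not_less_Least by blast

lemma silent_steps:
  assumes "q \<in> pairs" "n \<le> skip q"
  shows "(silent_next ^^ n) q \<in> pairs \<and> pair_sequent ((silent_next ^^ n) q) = pair_sequent q"
  using assms(2)
proof (induction n)
  case 0
  show ?case using assms by simp
next
  case (Suc n)
  then show ?case
    using silent_next(1,2)[of "(silent_next ^^ n) q"] silent_before_skip[of n q] by simp
qed

definition states :: "(nat list \<times> 'f sub) set" where
  "states = {q \<in> pairs. \<not> silent (fst q)}"

lemma reach:
  assumes "q \<in> pairs"
  shows "reach q \<in> states" "pair_sequent (reach q) = pair_sequent q"
proof -
  have "\<not> silent (fst ((silent_next ^^ skip q) q))"
    unfolding skip_def using silent_terminates[OF assms] by (rule LeastI_ex)
  then show "reach q \<in> states" "pair_sequent (reach q) = pair_sequent q"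
    using silent_steps[OF assms, of "skip q"] by (simp_all add: states_def reach_def)
qed

section \<open>The graph of pushed rule instances\<close>

definition rule_at :: "nat list \<Rightarrow> ('f, 'q, 'p) rule_inst" where
  "rule_at a = (case the (subtree Pr a) of Inf R ds \<Rightarrow> R)"

definition inst_of :: "nat list \<times> 'f sub \<Rightarrow> ('f, 'q, 'p) rule_inst" where
  "inst_of q = push N (snd q) (rule_at (fst q))"

definition child :: "nat list \<times> 'f sub \<Rightarrow> nat \<Rightarrow> nat list \<times> 'f sub" where
  "child q j = (fst q @ [j], premise_subst N (snd q) (rule_at (fst q)))"

definition succs :: "nat list \<times> 'f sub \<Rightarrow> (nat list \<times> 'f sub) list" where
  "succs q = map (\<lambda>j. reach (child q j)) [0..<length (prems (rule_at (fst q)))]"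

lemma states_cases:
  assumes "q \<in> states"
  obtains a \<theta> R ds where "q = (a, \<theta>)" "\<theta> \<in> subs" "subtree Pr a = Some (Inf R ds)"
    "rule_of R \<noteq> R_Subst" "rule_at a = R" "length ds = length (prems R)"
proof -
  obtain a \<theta> where q: "q = (a, \<theta>)" by (cases q)
  then obtain D where D: "subtree Pr a = Some D" "\<theta> \<in> subs"
    using assms by (auto simp: states_def pairs_def)
  then obtain R ds where "D = Inf R ds" "rule_of R \<noteq> R_Subst"
    using assms q by (cases D) (auto simp: states_def silent_def)
  moreover from this have "length ds = length (prems R)"
    using subtree_Inf(2)[of a R ds] D by (metis length_map)
  ultimately show thesis using that q D by (simp add: rule_at_def)
qed

lemma concl_inst_of: "q \<in> states \<Longrightarrow> concl (inst_of q) = pair_sequent q"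
  by (erule states_cases) (simp add: inst_of_def pair_sequent_def concl_push[OF subtree_Inf(1)])

lemma valid_inst_of:
  assumes "q \<in> states"
  shows "valid_inst \<Sigma> \<Phi> (inst_of q)"
  using assms
proof (rule states_cases)
  fix a \<theta> R ds
  assume q: "q = (a, \<theta>)" "\<theta> \<in> subs" "rule_of R \<noteq> R_Subst" "rule_at a = R"
    and R: "subtree Pr a = Some (Inf R ds)"
  show ?thesis
    using valid_push[OF subtree_Inf(1)[OF R] q(3) subtree_Inf(3,4)[OF R] subs_atomic[OF q(2)] subs_wf[OF q(2)]] q
    by (simp add: inst_of_def)
qed

lemma child:
  assumes "q \<in> states" "j < length (prems (rule_at (fst q)))"
  shows "child q j \<in> pairs" "pair_sequent (child q j) = prems (inst_of q) ! j"
    "edge Pr (fst q) (fst (child q j))"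
  using assms(1)
proof -
  from assms(1) obtain a \<theta> R ds where q: "q = (a, \<theta>)" "\<theta> \<in> subs" "subtree Pr a = Some (Inf R ds)"
    "rule_of R \<noteq> R_Subst" "rule_at a = R" "length ds = length (prems R)"
    by (rule states_cases)
  have j: "j < length ds" using assms(2) q by simp
  then have sub: "subtree Pr (a @ [j]) = Some (ds ! j)" using q by (simp add: subtree_snoc)
  show "child q j \<in> pairs"
    using q sub premise_subst_in_subs by (simp add: child_def pairs_def del: premise_subst_def)
  have "prems R ! j = root_sequent (ds ! j)"
    using subtree_Inf(2)[OF q(3)] j by (metis nth_map)
  then show "pair_sequent (child q j) = prems (inst_of q) ! j"
    using q sub j prems_push[OF subtree_Inf(1)[OF q(3)] q(4) subtree_Inf(3)[OF q(3)], of \<theta>]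
    by (simp add: child_def pair_sequent_def inst_of_def del: premise_subst_def)
  show "edge Pr (fst q) (fst (child q j))"
    using q j by (simp add: child_def edge_def)
qed

lemma length_prems_inst_of:
  assumes "q \<in> states"
  shows "length (prems (inst_of q)) = length (prems (rule_at (fst q)))"
proof -
  from assms obtain a \<theta> R ds where q: "q = (a, \<theta>)" "\<theta> \<in> subs" "subtree Pr a = Some (Inf R ds)"
    "rule_of R \<noteq> R_Subst" "rule_at a = R" "length ds = length (prems R)"
    by (rule states_cases)
  then show ?thesis
    using prems_push[OF subtree_Inf(1)[OF q(3)] q(4) subtree_Inf(3)[OF q(3)], of \<theta>]
    by (simp add: inst_of_def)
qed

lemma root_in_pairs: "([], Var) \<in> pairs"
  by (simp add: pairs_def Var_in_subs)

text \<open>Premise \<open>j\<close> of a pushed instance is the sequent of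
  \<open>child q j\<close>; \<open>reach\<close> preserves this sequent and ends in a state whose
  pushed instance concludes it.\<close>

sublocale graph: inst_graph states inst_of succs "reach ([], Var)"
proof
  have "finite pairs" unfolding pairs_def by (intro finite_cartesian_product finite_addresses finite_subs)
  then show "finite states" by (simp add: states_def)
  show "reach ([], Var) \<in> states" using reach(1) root_in_pairs by blast
  fix q assume q: "q \<in> states"
  show "set (succs q) \<subseteq> states"
    using reach(1)[OF child(1)[OF q]] by (auto simp: succs_def simp del: split_paired_All)
  have "concl (inst_of (reach (child q j))) = prems (inst_of q) ! j"
    if "j < length (prems (rule_at (fst q)))" for j
    using child(1,2)[OF q that] reach by (simp add: concl_inst_of)
  then show "prems (inst_of q) = map (\<lambda>q. concl (inst_of q)) (succs q)"
    by (auto simp: succs_def length_prems_inst_of[OF q] intro!: nth_equalityI)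
qed

text \<open>A bud edge keeps the state and ends at an inference, so two bud edges never follow each
  other; this is the nonemptiness required by \<open>concat_blocks\<close>.\<close>

lemma edge_tree:
  assumes "edge graph.tree a b"
  shows "graph.state a \<in> states"
    and "(\<exists>S c. subtree graph.tree a = Some (Bud S c) \<and> graph.state b = graph.state a \<and>
            (\<exists>R ds. subtree graph.tree b = Some (Inf R ds))) \<or>
         (\<exists>ds. subtree graph.tree a = Some (Inf (inst_of (graph.state a)) ds) \<and>
            last b < length (prems (rule_at (fst (graph.state a)))) \<and>
            graph.state b = reach (child (graph.state a) (last b)))"
proof -
  obtain D where D: "subtree graph.tree a = Some D"
    using assms by (auto simp: edge_def split: option.splits)
  show *: "graph.state a \<in> states" using graph.state_in_Q[OF D] .
  show "(\<exists>S c. subtree graph.tree a = Some (Bud S c) \<and> graph.state b = graph.state a \<and>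
            (\<exists>R ds. subtree graph.tree b = Some (Inf R ds))) \<or>
         (\<exists>ds. subtree graph.tree a = Some (Inf (inst_of (graph.state a)) ds) \<and>
            last b < length (prems (rule_at (fst (graph.state a)))) \<and>
            graph.state b = reach (child (graph.state a) (last b)))"
  proof (cases D)
    case (Bud S c)
    then have "b = c" using assms D by (simp add: edge_def)
    then show ?thesis using D Bud graph.subtree_tree_Bud[of a S c] by blast
  next
    case (Inf R ds)
    then obtain j where j: "j < length ds" "b = a @ [j]" using assms D by (auto simp: edge_def)
    have R: "R = inst_of (graph.state a)" "length ds = length (succs (graph.state a))"
      using graph.subtree_tree_Inf(1,2)[of a R ds] D Inf by auto
    then have "j < length (prems (rule_at (fst (graph.state a))))"
      using j(1) by (simp add: succs_def)
    then show ?thesis using D Inf R j by (simp add: succs_def)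
  qed
qed


section \<open>Transfer of traces and of the global trace condition\<close>

lemma silent_trace:
  assumes "q \<in> pairs" "silent (fst q)" "subtree Pr (fst q) = Some d"
    and step: "case d of Bud S c \<Rightarrow> C' = C | Inf R ds \<Rightarrow> trace_step R j C C'"
  shows "subst (snd (silent_next q)) C' = subst (snd q) C"
proof -
  obtain a \<theta> where q: "q = (a, \<theta>)" by (cases q)
  have "(a, \<theta>) \<in> pairs" "silent a" using assms q by auto
  then show ?thesis
  proof (cases rule: silent_cases)
    case (Bud S c)
    then have "d = Bud S c" using q assms(3) by simp
    then show ?thesis unfolding q Bud(2) using step by simp
  next
    case (Subst \<Gamma> \<Delta> \<sigma> d')
    then have "d = Inf (Subst \<Gamma> \<Delta> \<sigma>) [d']" using q assms(3) by simp
    \<comment> \<open>Here \<open>C\<close> is \<open>subst \<sigma> C'\<close>, so applying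
      \<open>\<theta>\<close> to \<open>C\<close> gives the composed instance of
      \<open>C'\<close>.\<close>
    then show ?thesis unfolding q Subst(2) using step by (simp add: subst_subst)
  qed
qed

lemma child_trace:
  assumes "q \<in> states" "j < length (prems (rule_at (fst q)))" "subtree Pr (fst q) = Some d"
    and "C \<in> fst (root_sequent d)"
    and "case d of Bud S c \<Rightarrow> C' = C | Inf R ds \<Rightarrow> trace_step R j C C'"
  shows "trace_step (inst_of q) j (subst (snd q) C) (subst (snd (child q j)) C')"
  using assms(1)
proof (rule states_cases)
  fix a \<theta> R ds
  assume q: "q = (a, \<theta>)" "rule_of R \<noteq> R_Subst" "rule_at a = R"
    and R: "subtree Pr a = Some (Inf R ds)"
  have "d = Inf R ds" using assms(3) q(1) R by simp
  then show ?thesis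
    using trace_step_push[OF subtree_Inf(1)[OF R] q(2) subtree_Inf(3)[OF R], of j C C' \<theta>] assms(2,4,5) q
    by (simp add: inst_of_def child_def del: premise_subst_def)
qed

lemma child_progress:
  assumes "q \<in> states" "j < length (prems (rule_at (fst q)))" "subtree Pr (fst q) = Some (Inf R ds)"
    and "progress_step R j C C'"
  shows "progress_step (inst_of q) j (subst (snd q) C) (subst (snd (child q j)) C')"
  using progress_step_push[OF subtree_Inf(1,3)[OF assms(3)], of j C C' "snd q"] assms
  by (simp add: inst_of_def child_def rule_at_def del: premise_subst_def)

text \<open>Turns a path of the folded tree into a path of \<open>Pr\<close>, where the trace
  condition is known. \<open>h i\<close> is the position at which the expansion reaches the state of
  \<open>e i\<close>.\<close>

lemma path_expansion:
  assumes "infinite_path graph.tree e"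
  shows "\<exists>p h. infinite_path Pr (\<lambda>m. fst (p m)) \<and> (\<forall>m. p m \<in> pairs) \<and>
    (\<forall>i. p (h i) = graph.state (e i)) \<and>
    (\<forall>i S c. subtree graph.tree (e i) = Some (Bud S c) \<longrightarrow> h (Suc i) = h i) \<and>
    (\<forall>i R ds. subtree graph.tree (e i) = Some (Inf R ds) \<longrightarrow>
       p (Suc (h i)) = child (graph.state (e i)) (last (e (Suc i))) \<and> h i < h (Suc i)) \<and>
    (\<forall>i m. h i < m \<and> m < h (Suc i) \<longrightarrow> silent (fst (p m)) \<and> p (Suc m) = silent_next (p m)) \<and>
    (\<forall>m. \<exists>i. h i \<le> m \<and> m < h (Suc i))"
proof -
  define q where "q i = graph.state (e i)" for i
  define j where "j i = last (e (Suc i))" for i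
  define bud where "bud i \<longleftrightarrow> (\<exists>S c. subtree graph.tree (e i) = Some (Bud S c))" for i
  \<comment> \<open>One edge to the child and then the silent steps up to the next state; a bud edge
    stays at its state and contributes nothing.\<close>
  define len where "len i = (if bud i then 0 else Suc (skip (child (q i) (j i))))" for i
  define blk where "blk i l = (case l of 0 \<Rightarrow> q i | Suc l \<Rightarrow> (silent_next ^^ l) (child (q i) (j i)))"
    for i l
  have edge: "edge graph.tree (e i) (e (Suc i))" for i
    using assms by (simp add: infinite_path_def)
  have q: "q i \<in> states" for i
    using edge_tree(1)[OF edge] by (simp add: q_def)
  have bud: "q (Suc i) = q i \<and> \<not> bud (Suc i)" if "bud i" for i
    using edge_tree(2)[OF edge[of i]] that by (auto simp: bud_def q_def)
  have no_bud: "j i < length (prems (rule_at (fst (q i)))) \<and> q (Suc i) = reach (child (q i) (j i))"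
    if "\<not> bud i" for i
    using edge_tree(2)[OF edge[of i]] that by (auto simp: bud_def q_def j_def)
  have "blk i (len i) = blk (Suc i) 0" for i
    using bud no_bud by (simp add: blk_def len_def reach_def)
  moreover have "len i > 0 \<or> len (Suc i) > 0" for i
    using bud[of i] by (auto simp: len_def)
  ultimately have "\<exists>p h. h 0 = 0 \<and> (\<forall>i. h (Suc i) = h i + len i) \<and>
      (\<forall>i l. l \<le> len i \<longrightarrow> p (h i + l) = blk i l) \<and> (\<forall>m. \<exists>i. h i \<le> m \<and> m < h (Suc i))"
    by (rule concat_blocks)
  then obtain p h where "\<forall>i. h (Suc i) = h i + len i"
    and "\<forall>i l. l \<le> len i \<longrightarrow> p (h i + l) = blk i l"
    and "\<forall>m. \<exists>i. h i \<le> m \<and> m < h (Suc i)"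
    by blast
  then have h: "h (Suc i) = h i + len i" and p: "l \<le> len i \<Longrightarrow> p (h i + l) = blk i l"
    and ix: "\<exists>i. h i \<le> m \<and> m < h (Suc i)" for i l m
    by blast+
  have inner: "p (h i + l) \<in> pairs \<and> silent (fst (p (h i + l))) \<and>
      p (Suc (h i + l)) = silent_next (p (h i + l))" if "0 < l" "l < len i" for i l
  proof -
    obtain l' where l': "l = Suc l'" using \<open>0 < l\<close> by (cases l) auto
    have l: "\<not> bud i" "l' < skip (child (q i) (j i))"
      using that l' by (auto simp: len_def split: if_splits)
    have "child (q i) (j i) \<in> pairs" using child(1)[OF q] no_bud l(1) by blast
    then show ?thesis
      using p[of l i] p[of "Suc l" i] that l' l(2) silent_before_skip silent_steps
      by (simp add: blk_def)
  qed
  have first: "p (h i) = q i" for i using p[of 0 i] by (simp add: blk_def)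
  have nxt: "p (Suc (h i)) = child (q i) (j i)" if "\<not> bud i" for i
    using p[of 1 i] that by (simp add: blk_def len_def)
  have all: "p m \<in> pairs \<and> edge Pr (fst (p m)) (fst (p (Suc m)))" for m
  proof -
    obtain i where i: "h i \<le> m" "m < h (Suc i)" using ix by blast
    then obtain l where l: "m = h i + l" "l < len i" using h by (metis le_iff_add nat_add_left_cancel_less)
    show ?thesis
    proof (cases "l = 0")
      case True
      then have "\<not> bud i" using l by (auto simp: len_def)
      then show ?thesis
        using l True first nxt q child(3)[OF q] no_bud by (simp add: states_def)
    next
      case False
      then show ?thesis using inner[of l i] silent_next(3)[of "p m"] l by simp
    qed
  qed
  show ?thesis
  proof (intro exI[of _ p] exI[of _ h] conjI allI impI)
    show "infinite_path Pr (\<lambda>m. fst (p m))" using all by (simp add: infinite_path_def)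
    fix i
    show "p i \<in> pairs" using all by blast
    show "\<exists>j. h j \<le> i \<and> i < h (Suc j)" using ix .
    show "p (h i) = graph.state (e i)" using first by (simp add: q_def)
    show "h (Suc i) = h i" if "subtree graph.tree (e i) = Some (Bud S c)" for S c
      using that h by (auto simp: len_def bud_def)
    show "p (Suc (h i)) = child (graph.state (e i)) (last (e (Suc i)))" "h i < h (Suc i)"
      if "subtree graph.tree (e i) = Some (Inf R ds)" for R ds
      using that nxt[of i] h[of i] by (simp_all add: bud_def q_def j_def len_def)
    show "silent (fst (p m))" "p (Suc m) = silent_next (p m)" if "h i < m \<and> m < h (Suc i)" for m
    proof -
      have "m - h i < len i" using that h[of i] by linarith
      then show "silent (fst (p m))" "p (Suc m) = silent_next (p m)"
        using inner[of "m - h i" i] that by simp_all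
    qed
  qed
qed

text \<open>A trace of the expanded path is instantiated with the pending substitutions and sampled
  at the positions \<open>h i\<close>. Its value is constant along silent stretches, and silent
  nodes never progress, so sampling loses no progressing point.\<close>

lemma global_trace_tree: "global_trace_condition graph.tree"
  unfolding global_trace_condition_def
proof (intro allI impI)
  fix e assume path: "infinite_path graph.tree e"
  obtain p h where p: "infinite_path Pr (\<lambda>m. fst (p m))" "\<forall>m. p m \<in> pairs"
    and "\<forall>i. p (h i) = graph.state (e i)"
    and "\<forall>i S c. subtree graph.tree (e i) = Some (Bud S c) \<longrightarrow> h (Suc i) = h i"
    and "\<forall>i R ds. subtree graph.tree (e i) = Some (Inf R ds) \<longrightarrow>
       p (Suc (h i)) = child (graph.state (e i)) (last (e (Suc i))) \<and> h i < h (Suc i)"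
    and "\<forall>i m. h i < m \<and> m < h (Suc i) \<longrightarrow> silent (fst (p m)) \<and> p (Suc m) = silent_next (p m)"
    and "\<forall>m. \<exists>i. h i \<le> m \<and> m < h (Suc i)"
    using path_expansion[OF path] by blast
  then have pairs: "p m \<in> pairs" and start: "p (h i) = graph.state (e i)"
    and bud: "subtree graph.tree (e i) = Some (Bud S c) \<Longrightarrow> h (Suc i) = h i"
    and inf: "subtree graph.tree (e i) = Some (Inf R ds) \<Longrightarrow>
       p (Suc (h i)) = child (graph.state (e i)) (last (e (Suc i))) \<and> h i < h (Suc i)"
    and inner: "h i < m \<Longrightarrow> m < h (Suc i) \<Longrightarrow> silent (fst (p m)) \<and> p (Suc m) = silent_next (p m)"
    and ix: "\<exists>i. h i \<le> m \<and> m < h (Suc i)" for i m S c R ds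
    by blast+
  have mono: "h i \<le> h j" if "i \<le> j" for i j
    using that
  proof (induction j rule: dec_induct)
    case (step n)
    obtain d where d: "subtree graph.tree (e n) = Some d"
      using path by (fastforce simp: infinite_path_def edge_def split: option.splits)
    have "h n \<le> h (Suc n)"
    proof (cases d)
      case (Bud S c)
      then show ?thesis using bud d by simp
    next
      case (Inf R ds)
      then show ?thesis using inf d by (simp add: less_imp_le)
    qed
    then show ?case using step by simp
  qed simp
  obtain k C0 where tr0: "trace Pr (\<lambda>i. fst (p (k + i))) C0"
    and prog0: "infinite {i. progressing_point Pr (\<lambda>i. fst (p (k + i))) C0 i}"
    using global_trace p(1) unfolding global_trace_condition_def by blast
  \<comment> \<open>Reindexes the trace by positions of \<open>p\<close>; it is meaningful from
    \<open>k\<close> on.\<close>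
  define C where "C m = C0 (m - k)" for m
  have tr: "inductive_atom (C m) \<and> (\<exists>d. subtree Pr (fst (p m)) = Some d \<and> C m \<in> fst (root_sequent d) \<and>
      (case d of Bud S c \<Rightarrow> C (Suc m) = C m
       | Inf R ds \<Rightarrow> trace_step R (last (fst (p (Suc m)))) (C m) (C (Suc m))))" if "k \<le> m" for m
  proof -
    have "C0 (m - k) = C m" "C0 (Suc (m - k)) = C (Suc m)" "k + (m - k) = m" "k + Suc (m - k) = Suc m"
      using that by (simp_all add: C_def Suc_diff_le)
    with tr0[unfolded trace_def, rule_format, of "m - k"] show ?thesis by (simp only:)
  qed
  define v where "v m = subst (snd (p m)) (C m)" for m
  \<comment> \<open>The trace may begin inside a block, so the new one starts at the next block
    boundary.\<close>
  obtain K where K: "k \<le> h K" using ix[of k] by (meson less_imp_le)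
  have hK: "k \<le> h i" if "K \<le> i" for i using K mono[OF that] by simp
  have edge: "edge graph.tree (e i) (e (Suc i))" for i
    using path by (simp add: infinite_path_def)
  have const: "v (h (Suc i)) = v (Suc (h i))" if "K \<le> i" "subtree graph.tree (e i) = Some (Inf R ds)" for i R ds
  proof -
    have "v m = v (Suc (h i))" if "Suc (h i) \<le> m" "m \<le> h (Suc i)" for m
      using that
    proof (induction m rule: dec_induct)
      case (step m)
      have m: "silent (fst (p m))" "p (Suc m) = silent_next (p m)" using inner[of i m] step by auto
      have "k \<le> m" using hK[OF \<open>K \<le> i\<close>] step by simp
      from tr[OF this] obtain d where d: "subtree Pr (fst (p m)) = Some d"
        "case d of Bud S c \<Rightarrow> C (Suc m) = C m
         | Inf R ds \<Rightarrow> trace_step R (last (fst (p (Suc m)))) (C m) (C (Suc m))" by blast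
      have "v (Suc m) = v m"
        using silent_trace[OF pairs m(1) d] m(2) by (simp add: v_def)
      then show ?case using step by simp
    qed simp
    from this[of "h (Suc i)"] show ?thesis using inf[OF that(2)] by simp
  qed
  have real: "last (e (Suc i)) < length (prems (rule_at (fst (p (h i))))) \<and> R = inst_of (p (h i))"
    if "subtree graph.tree (e i) = Some (Inf R ds)" for i R ds
    using edge_tree(2)[OF edge[of i]] that start by auto
  have states: "p (h i) \<in> states" for i using edge_tree(1)[OF edge[of i]] start by simp
  define D where "D i = v (h (K + i))" for i
  have "trace graph.tree (\<lambda>i. e (K + i)) D"
    unfolding trace_def
  proof (intro allI conjI)
    fix i
    have k: "k \<le> h (K + i)" by (rule hK) simp
    from tr[OF this] show "inductive_atom (D i)"
      by (auto simp: inductive_atom_def D_def v_def)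
    obtain d where d: "subtree graph.tree (e (K + i)) = Some d"
      using edge[of "K + i"] by (auto simp: edge_def split: option.splits)
    obtain d0 where d0: "subtree Pr (fst (p (h (K + i)))) = Some d0"
      "C (h (K + i)) \<in> fst (root_sequent d0)"
      "case d0 of Bud S c \<Rightarrow> C (Suc (h (K + i))) = C (h (K + i))
       | Inf R ds \<Rightarrow> trace_step R (last (fst (p (Suc (h (K + i)))))) (C (h (K + i))) (C (Suc (h (K + i))))"
      using tr[OF k] by blast
    have "root_sequent d = pair_sequent (p (h (K + i)))"
      using graph.root_sequent_subtree[OF d] concl_inst_of[OF states[of "K + i"]] start by simp
    then have "D i \<in> fst (root_sequent d)"
      using d0(1,2) by (simp add: pair_sequent_def D_def v_def)
    moreover have "case d of Bud S c \<Rightarrow> D (Suc i) = D i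
        | Inf R ds \<Rightarrow> trace_step R (last (e (K + Suc i))) (D i) (D (Suc i))"
    proof (cases d)
      case (Bud S c)
      then show ?thesis using bud d by (simp add: D_def)
    next
      case (Inf R ds)
      then have R: "subtree graph.tree (e (K + i)) = Some (Inf R ds)" using d by simp
      have nxt: "p (Suc (h (K + i))) = child (p (h (K + i))) (last (e (K + Suc i)))"
        using inf[OF R] start by simp
      have "D (Suc i) = v (Suc (h (K + i)))" using const[OF _ R] by (simp add: D_def)
      moreover have "last (fst (p (Suc (h (K + i))))) = last (e (K + Suc i))"
        unfolding nxt by (simp add: child_def)
      then have d0': "case d0 of Bud S c \<Rightarrow> C (Suc (h (K + i))) = C (h (K + i))
          | Inf R ds \<Rightarrow> trace_step R (last (e (K + Suc i))) (C (h (K + i))) (C (Suc (h (K + i))))"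
        using d0(3) by (cases d0) simp_all
      have "last (e (K + Suc i)) < length (prems (rule_at (fst (p (h (K + i))))))"
        "R = inst_of (p (h (K + i)))"
        using real[OF R] by simp_all
      with child_trace[OF states this(1) d0(1,2) d0']
      have "trace_step R (last (e (K + Suc i))) (D i) (v (Suc (h (K + i))))"
        by (simp only: D_def v_def nxt)
      ultimately show ?thesis using Inf by simp
    qed
    ultimately show "\<exists>d. subtree graph.tree (e (K + i)) = Some d \<and> D i \<in> fst (root_sequent d) \<and>
        (case d of Bud S c \<Rightarrow> D (Suc i) = D i
         | Inf R ds \<Rightarrow> trace_step R (last (e (K + Suc i))) (D i) (D (Suc i)))"
      using d by blast
  qed
  moreover have "\<exists>i\<ge>n. progressing_point graph.tree (\<lambda>i. e (K + i)) D i" for n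
  proof -
    obtain m0 where m0: "h (K + n) \<le> m0" "progressing_point Pr (\<lambda>i. fst (p (k + i))) C0 m0"
      using prog0 unfolding finite_nat_set_iff_bounded by (auto simp: not_less)
    define m where "m = k + m0"
    obtain R ds where R: "subtree Pr (fst (p m)) = Some (Inf R ds)"
      "progress_step R (last (fst (p (Suc m)))) (C m) (C (Suc m))"
      using m0(2) by (auto simp: progressing_point_def m_def C_def)
    obtain i where i: "h i \<le> m" "m < h (Suc i)" using ix by blast
    \<comment> \<open>Otherwise block \<open>i\<close> would end by \<open>h (K + n)\<close>, before
      the chosen progressing point.\<close>
    have "K + n \<le> i"
      using mono[of "Suc i" "K + n"] i(2) m0(1) by (cases "K + n \<le> i") (auto simp: m_def)
    then obtain i' where i': "i = K + i'" "n \<le> i'" by (metis add_le_cancel_left le_iff_add add.assoc)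
    have "rule_of R \<noteq> R_Subst" using R(2) by (cases R) auto
    then have "\<not> silent (fst (p m))" using R(1) by (simp add: silent_def)
    then have m: "m = h i" using inner[of i m] i by (cases "h i < m") auto
    obtain T where T: "subtree graph.tree (e i) = Some T"
      using edge[of i] by (auto simp: edge_def split: option.splits)
    \<comment> \<open>Block \<open>i\<close> contains \<open>m\<close> and so is nonempty, which
      rules out a bud.\<close>
    then obtain R' ds' where R': "subtree graph.tree (e i) = Some (Inf R' ds')"
      using bud[of i] i by (cases T) auto
    have nxt: "p (Suc m) = child (p m) (last (e (Suc i)))"
      using inf[OF R'] start m by simp
    then have "last (fst (p (Suc m))) = last (e (Suc i))" by (simp add: child_def)
    then have "progress_step R' (last (e (Suc i))) (v m) (v (Suc m))"
      using child_progress[OF states[of i], of "last (e (Suc i))" R ds] R real[OF R'] m nxt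
      by (simp add: v_def)
    then have "progressing_point graph.tree (\<lambda>i. e (K + i)) D i'"
      unfolding progressing_point_def D_def using R' const[OF _ R'] m i' by auto
    then show ?thesis using i'(2) by blast
  qed
  then have "infinite {i. progressing_point graph.tree (\<lambda>i. e (K + i)) D i}"
    unfolding finite_nat_set_iff_bounded by (auto simp: not_less)
  ultimately show "\<exists>k C. trace graph.tree (\<lambda>i. e (k + i)) C \<and>
      infinite {i. progressing_point graph.tree (\<lambda>i. e (k + i)) C i}" by blast
qed

lemma rules_used_tree: "rules_used graph.tree \<subseteq> rules_used Pr - {R_Subst}"
proof -
  have "rule_of (inst_of q) \<in> rules_used Pr - {R_Subst}" if "q \<in> states" for q
    using that
  proof (rule states_cases)
    fix a \<theta> R ds
    assume q: "q = (a, \<theta>)" "rule_of R \<noteq> R_Subst" "rule_at a = R"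
      and R: "subtree Pr a = Some (Inf R ds)"
    have "rule_of (inst_of q) = rule_of R" using q by (simp add: inst_of_def)
    then show ?thesis using q(2) subtree_Inf(5)[OF R] by (simp add: rules_used_def)
  qed
  then have "(\<lambda>q. rule_of (inst_of q)) ` states \<subseteq> rules_used Pr - {R_Subst}"
    by (rule image_subsetI)
  with graph.rules_used_tree show ?thesis by (rule order_trans)
qed

lemma Subst_free_proof:
  "clkid_omega_proof \<Sigma> \<Phi> graph.tree" "root_sequent graph.tree = root_sequent Pr"
proof -
  show "clkid_omega_proof \<Sigma> \<Phi> graph.tree"
    unfolding clkid_omega_proof_def
    using graph.pre_proof_tree[OF valid_inst_of] global_trace_tree by (rule conjI)
  show "root_sequent graph.tree = root_sequent Pr"
    using graph.root_sequent_tree concl_inst_of[OF graph.start] reach[OF root_in_pairs]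
    by (simp add: pair_sequent_def)
qed

end

theorem theorem4:
  fixes \<Sigma> :: "('f, 'q, 'p) signature"
    and \<Phi> :: "('f, 'q, 'p) production set"
    and \<Gamma> \<Delta> :: "('f, 'q, 'p) fm set"
    and Pr :: "('f, 'q, 'p) deriv_tree"
  assumes "inductive_definition_set \<Sigma> \<Phi>"
    and "clkid_omega_minus_proof \<Sigma> \<Phi> Pr"
    and "root_sequent Pr = (\<Gamma>, \<Delta>)"
    and "\<forall>\<Gamma>' \<Delta>' \<theta>. Subst \<Gamma>' \<Delta>' \<theta> \<in> rule_insts Pr \<longrightarrow> atomic \<theta>"
  shows "\<exists>Pr'. clkid_omega_minus_proof \<Sigma> \<Phi> Pr' \<and> root_sequent Pr' = (\<Gamma>, \<Delta>) \<and>
           R_Subst \<notin> rules_used Pr' \<and> rules_used Pr' \<subseteq> rules_used Pr"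
proof -
  have Pr: "pre_proof \<Sigma> \<Phi> Pr" "global_trace_condition Pr" "R_Cut \<notin> rules_used Pr"
    using assms(2) by (auto simp: clkid_omega_minus_proof_def clkid_omega_proof_def)
  have "finite (inst_vars R)" if R: "R \<in> rule_insts Pr" for R
  proof -
    obtain a ds where "subtree Pr a = Some (Inf R ds)" using subtree_rule_insts[OF R] by blast
    then show ?thesis using Pr(1) by (auto simp: pre_proof_def intro: finite_inst_vars)
  qed
  then have "finite (\<Union>R\<in>rule_insts Pr. inst_vars R)" by (simp add: finite_rule_insts)
  \<comment> \<open>A single bound for the whole proof exists because the tree has finitely many
    rule instances, each with finitely many relevant variables.\<close>
  then obtain N where N: "(\<Union>R\<in>rule_insts Pr. inst_vars R) \<subseteq> {..<N}"
    unfolding finite_nat_set_iff_bounded by blast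
  interpret atomic_proof \<Sigma> \<Phi> Pr N
    using Pr(1,2) N assms(4) by unfold_locales auto
  show ?thesis
    using Subst_free_proof rules_used_tree Pr(3) assms(3)
    by (intro exI[of _ graph.tree]) (auto simp: clkid_omega_minus_proof_def)
qed

end
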